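(* Every hypothesis class $\mathcal{H}\subseteq\{0,1\}^{\mathcal{X}}$ must satisfy exactly one of the following: 1. $\mathcal{H}$ is learnable by a pure private learner. 2. Any pure semi-private learner for $\mathcal{H}$ must have public sample of size $n_{\mathsf{pub}}=\Omega(1/\alpha)$, where $\alpha$ is the excess error.
   Context: Setting: $\mathcal{X}$ is a domain, $\mathcal{Z}=\mathcal{X}\times\{0,1\}$, and for a distribution $\mathcal{D}$ over $\mathcal{Z}$ and $h:\mathcal{X}\to\{0,1\}$, $\mathrm{err}(h;\mathcal{D})=\Pr_{(x,y)\sim\mathcal{D}}[h(x)\neq y]$. Differential privacy: a randomized algorithm $\mathcal{M}$ on datasets is (pure) $\epsilon$-differentially private if for all datasets $S,S'$ differing in exactly one data point and every measurable set $O$ of outputs, $\Pr[\mathcal{M}(S)\in O]\le e^{\epsilon}\Pr[\mathcal{M}(S')\in O]$. $(\alpha,\beta,\epsilon)$-pure semi-private learner for $\mathcal{H}$ with private sample size $n_{\mathsf{priv}}$ and public sample size $n_{\mathsf{pub}}$: a randomized algorithm $\mathcal{A}$ such that (1) for every distribution $\mathcal{D}$ over $\mathcal{Z}$, given labeled datasets $S_{\mathsf{priv}}\sim\mathcal{D}^{n_{\mathsf{priv}}}$ and $S_{\mathsf{pub}}\sim\mathcal{D}^{n_{\mathsf{pub}}}$, with probability at least $1-\beta$ over the samples and the coins of $\mathcal{A}$, the output $\hat h=\mathcal{A}(S_{\mathsf{priv}},S_{\mathsf{pub}})\in\{0,1\}^{\mathcal{X}}$ (not necessarily in $\mathcal{H}$)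 satisfies $\mathrm{err}(\hat h;\mathcal{D})\le\inf_{h\in\mathcal{H}}\mathrm{err}(h;\mathcal{D})+\alpha$; and (2) for every $S\in\mathcal{Z}^{n_{\mathsf{pub}}}$, $\mathcal{A}(\cdot,S)$ is $\epsilon$-differentially private. Here $\alpha$ is called the excess error. Pure semi-private learner for $\mathcal{H}$ (without parameters): an algorithm $\mathcal{A}$ together with functions $n_{\mathsf{priv}},n_{\mathsf{pub}}:(0,1)^2\to\mathbb{N}$ (where $0$ is allowed as a value of $n_{\mathsf{pub}}$), with $n_{\mathsf{pub}}(\alpha,\cdot)=o(1/\alpha^2)$, such that for every $\alpha,\beta\in(0,1)$, when given private and public samples of sizes $n_{\mathsf{priv}}(\alpha,\beta)$ and $n_{\mathsf{pub}}(\alpha,\beta)$, $\mathcal{A}$ is an $(\alpha,\beta,0.1)$-pure semi-private learner for $\mathcal{H}$. $\mathcal{H}$ is learnable by a pure private learner if there is a pure semi-private learner for $\mathcal{H}$ with $n_{\mathsf{pub}}(\alpha,\beta)=0$ for all $\alpha,\beta\in(0,1)$. *)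

theory Defs
  imports "HOL-Probability.Probability" "HOL-Library.Landau_Symbols"
begin

text \<open>
  The domain is the type \<open>'x\<close> with a sigma-algebra \<open>X\<close> on it, and the label set
  $\{0,1\}$ is \<open>bool\<close>.  A dataset of size \<open>n\<close> is an element of the \<open>n\<close>-fold product space,
  i.e. a function on \<open>{..<n}\<close> (extended by \<^const>\<open>undefined\<close>).
\<close>

definition examples :: "'x measure \<Rightarrow> ('x \<times> bool) measure" where
  "examples X = X \<Otimes>\<^sub>M count_space UNIV"

definition datasets :: "'x measure \<Rightarrow> nat \<Rightarrow> (nat \<Rightarrow> 'x \<times> bool) measure" where
  "datasets X n = (\<Pi>\<^sub>M i\<in>{..<n}. examples X)"

definition iid_sample :: "'z measure \<Rightarrow> nat \<Rightarrow> (nat \<Rightarrow> 'z) measure" where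
  "iid_sample D n = (\<Pi>\<^sub>M i\<in>{..<n}. D)"

definition err :: "('x \<Rightarrow> bool) \<Rightarrow> ('x \<times> bool) measure \<Rightarrow> real" where
  "err h D = \<P>(z in D. h (fst z) \<noteq> snd z)"

text \<open>
  For an uncountable domain there is in general no sigma-algebra on the set of all measurable
  predicates for which evaluation \<open>(h, x) \<mapsto> h x\<close> is jointly measurable (Aumann).  The
  output space of a randomized learner is therefore an arbitrary set of predicates carrying some
  sigma-algebra for which evaluation is jointly measurable.  This makes every \<open>h\<close> in the
  space, and every map \<open>h \<mapsto> err h D\<close>, measurable.
\<close>

definition hypothesis_space :: "'x measure \<Rightarrow> ('x \<Rightarrow> bool) measure \<Rightarrow> bool" where
  "hypothesis_space X Y \<longleftrightarrow> (\<lambda>(h, x). h x) \<in> Y \<Otimes>\<^sub>M X \<rightarrow>\<^sub>M count_space UNIV"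

definition differentially_private ::
  "'z measure \<Rightarrow> 'o measure \<Rightarrow> nat \<Rightarrow> real \<Rightarrow> ((nat \<Rightarrow> 'z) \<Rightarrow> 'o measure) \<Rightarrow> bool" where
  "differentially_private Z Y n \<epsilon> K \<longleftrightarrow>
     (\<forall>S \<in> space (\<Pi>\<^sub>M i\<in>{..<n}. Z). \<forall>S' \<in> space (\<Pi>\<^sub>M i\<in>{..<n}. Z).
        (\<exists>!i. i < n \<and> S i \<noteq> S' i) \<longrightarrow>
        (\<forall>E \<in> sets Y. measure (K S) E \<le> exp \<epsilon> * measure (K S') E))"

text \<open>
  A randomized algorithm is a probability kernel \<open>A\<close> sending a private and a public dataset to
  the law of the output.  The bind below is the law of the output over the samples and the
  internal coins.  The infimum is taken in \<^typ>\<open>ereal\<close>, so it is \<open>\<infinity>\<close> for the empty class.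
\<close>

definition semi_private_learner_with ::
  "'x measure \<Rightarrow> ('x \<Rightarrow> bool) set \<Rightarrow> ('x \<Rightarrow> bool) measure \<Rightarrow> nat \<Rightarrow> nat \<Rightarrow>
   real \<Rightarrow> real \<Rightarrow> real \<Rightarrow>
   ((nat \<Rightarrow> 'x \<times> bool) \<Rightarrow> (nat \<Rightarrow> 'x \<times> bool) \<Rightarrow> ('x \<Rightarrow> bool) measure) \<Rightarrow> bool" where
  "semi_private_learner_with X H Y n_priv n_pub \<alpha> \<beta> \<epsilon> A \<longleftrightarrow>
     (\<lambda>(S, T). A S T) \<in> datasets X n_priv \<Otimes>\<^sub>M datasets X n_pub \<rightarrow>\<^sub>M prob_algebra Y \<and>
     (\<forall>D. prob_space D \<and> sets D = sets (examples X) \<longrightarrow>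
        \<P>(h in (iid_sample D n_priv \<Otimes>\<^sub>M iid_sample D n_pub) \<bind> (\<lambda>(S, T). A S T).
            ereal (err h D) \<le> (INF h'\<in>H. ereal (err h' D)) + ereal \<alpha>) \<ge> 1 - \<beta>) \<and>
     (\<forall>T \<in> space (datasets X n_pub).
        differentially_private (examples X) Y n_priv \<epsilon> (\<lambda>S. A S T))"

text \<open>
  Below, \<open>A n m\<close> is the restriction of one algorithm to private datasets of size \<open>n\<close> and public
  datasets of size \<open>m\<close>; it sees the parameters \<open>\<alpha>\<close>, \<open>\<beta>\<close> only through these sizes.
  The values of \<open>n_priv\<close> and \<open>n_pub\<close> outside $(0,1)^2$ are irrelevant.
\<close>

definition pure_semi_private_learner ::
  "'x measure \<Rightarrow> ('x \<Rightarrow> bool) set \<Rightarrow> ('x \<Rightarrow> bool) measure \<Rightarrow>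
   (nat \<Rightarrow> nat \<Rightarrow> (nat \<Rightarrow> 'x \<times> bool) \<Rightarrow> (nat \<Rightarrow> 'x \<times> bool) \<Rightarrow> ('x \<Rightarrow> bool) measure) \<Rightarrow>
   (real \<Rightarrow> real \<Rightarrow> nat) \<Rightarrow> (real \<Rightarrow> real \<Rightarrow> nat) \<Rightarrow> bool" where
  "pure_semi_private_learner X H Y A n_priv n_pub \<longleftrightarrow>
     hypothesis_space X Y \<and>
     (\<forall>\<beta>\<in>{0<..<1}. (\<lambda>\<alpha>. real (n_pub \<alpha> \<beta>)) \<in> o[at_right 0](\<lambda>\<alpha>. 1 / \<alpha>\<^sup>2)) \<and>
     (\<forall>\<alpha>\<in>{0<..<1}. \<forall>\<beta>\<in>{0<..<1}.
        semi_private_learner_with X H Y (n_priv \<alpha> \<beta>) (n_pub \<alpha> \<beta>) \<alpha> \<beta> (1 / 10)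
          (A (n_priv \<alpha> \<beta>) (n_pub \<alpha> \<beta>)))"

definition pure_privately_learnable :: "'x measure \<Rightarrow> ('x \<Rightarrow> bool) set \<Rightarrow> bool" where
  "pure_privately_learnable X H \<longleftrightarrow>
     (\<exists>Y A n_priv n_pub. pure_semi_private_learner X H Y A n_priv n_pub \<and>
        (\<forall>\<alpha>\<in>{0<..<1}. \<forall>\<beta>\<in>{0<..<1}. n_pub \<alpha> \<beta> = 0))"

definition public_sample_lower_bound :: "'x measure \<Rightarrow> ('x \<Rightarrow> bool) set \<Rightarrow> bool" where
  "public_sample_lower_bound X H \<longleftrightarrow>
     (\<forall>Y A n_priv n_pub. pure_semi_private_learner X H Y A n_priv n_pub \<longrightarrow>
        (\<forall>\<beta>\<in>{0<..<1}. (\<lambda>\<alpha>. real (n_pub \<alpha> \<beta>)) \<in> \<Omega>[at_right 0](\<lambda>\<alpha>. 1 / \<alpha>)))"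

end

(*
If n_pub is not Omega(1/alpha), then alpha and alpha n_pub can be made small simultaneously.
Mix a target distribution D, with weight p of order 1/(n_pub + 1), into the noise distribution
(x0, uniform label).  Noise costs every hypothesis the same error 1/2, so excess error alpha on
the mixture is excess error alpha/p = O(alpha (n_pub + 1)) on D, which can be made arbitrarily
small.  With constant probability the public sample consists of noise only, hence it can be
simulated, and masking the private points one by one with noise preserves privacy.  This gives
private learners of arbitrarily small excess error with some constant failure probability b < 1.

To decrease b, run two learners on disjoint data and select one of the outputs on fresh data
with the exponential mechanism at scale s = O(delta).  If one output is worse by delta, the
probability of selecting it is at most E exp(-s d)^q <= (1 - s delta / 2)^q, so b turns into
b^2 + gamma, for any gamma > 0.
*)

theory Submission
  imports Defs
begin

text \<open>The guarantee of a semi-private learner covers only public and private samples from the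
  same distribution. Noise may therefore not simply replace the public sample: the private sample
  has to be noised as well, so that both come from one mixture. The lower bound is known to fail for
  a single \<beta> only, and only along some \<alpha> tending to 0. There the number m of public
  points may be unbounded. The weight p shrinks with m so that \<open>(1 - p) ^ m\<close> stays
  above a constant depending on \<beta> alone; hence all weak learners share one failure bound below
  1, which the amplification requires. Privacy must stay at 1/10 however many rounds of
  amplification are run. No stage reuses data: a changed point lies in one block, is seen by one
  stage, and the factor exp \<epsilon> is paid once. Selection compares two candidates on fresh
  points, which works for an arbitrary class. Finally, the learners for all accuracies must be
  packed into one algorithm that knows its parameters only through the sample sizes.\<close>

text \<open>Lifts the privacy inequality from events to integrals; this is how it passes through a
  later stage of a composition.\<close>

lemma nn_integral_le_of_emeasure_le:
  assumes sets: "sets M = sets N" and f: "f \<in> borel_measurable N"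
    and le: "\<And>E. E \<in> sets N \<Longrightarrow> emeasure M E \<le> c * emeasure N E"
  shows "(\<integral>\<^sup>+x. f x \<partial>M) \<le> c * (\<integral>\<^sup>+x. f x \<partial>N)"
proof -
  have "emeasure M E \<le> emeasure (scale_measure c N) E" for E
    by (cases "E \<in> sets N") (simp_all add: le sets emeasure_notin_sets)
  then have "M \<le> scale_measure c N"
    by (simp add: le_measure[of M "scale_measure c N"] sets le_fun_def)
  then have "nn_integral M f \<le> nn_integral (scale_measure c N) f"
    by (rule nn_integral_mono_measure[rotated]) (simp add: sets)
  with f show ?thesis by (simp add: nn_integral_scale_measure)
qed

section \<open>Privacy of composition on disjoint data\<close>

abbreviation samples :: "'z measure \<Rightarrow> nat \<Rightarrow> (nat \<Rightarrow> 'z) measure" where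
  "samples Z n \<equiv> Pi\<^sub>M {..<n} (\<lambda>_. Z)"

lemma prob_space_samples: "prob_space D \<Longrightarrow> prob_space (samples D n)"
  by (rule prob_space_PiM)

lemma emeasure_samples_PiE:
  assumes "prob_space D" "\<And>i. i < n \<Longrightarrow> A i \<in> sets D"
  shows "emeasure (samples D n) (Pi\<^sub>E {..<n} A) = (\<Prod>i<n. emeasure D (A i))"
proof -
  interpret prob_space D by fact
  interpret product_sigma_finite "\<lambda>_::nat. D" by standard
  show ?thesis using assms(2) by (intro emeasure_PiM) auto
qed

lemma prob_kernelD:
  assumes "K \<in> M \<rightarrow>\<^sub>M prob_algebra Y" "x \<in> space M"
  shows "prob_space (K x)" "sets (K x) = sets Y" "space (K x) = space Y" 
  using measurable_space[OF assms] by (auto simp: space_prob_algebra dest: sets_eq_imp_space_eq)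

text \<open>Equality of the samples is allowed, and j may lie out of range. This makes the relation
  stable under restriction to a block and under masking, both of which may remove the differing
  point.\<close>

definition near :: "nat \<Rightarrow> (nat \<Rightarrow> 'z) \<Rightarrow> (nat \<Rightarrow> 'z) \<Rightarrow> bool" where
  "near n S S' \<longleftrightarrow> (\<exists>j. \<forall>i<n. i \<noteq> j \<longrightarrow> S i = S' i)"

text \<open>The case S = S' lies outside the definition of privacy and is where \<epsilon> \<ge> 0
  enters.\<close>

lemma differentially_private_emeasure_le:
  assumes dp: "differentially_private Z Y n \<epsilon> K" and K: "K \<in> samples Z n \<rightarrow>\<^sub>M prob_algebra Y"
    and S: "S \<in> space (samples Z n)" "S' \<in> space (samples Z n)" and near: "near n S S'"
    and \<epsilon>: "\<epsilon> \<ge> 0" and E: "E \<in> sets Y"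
  shows "emeasure (K S) E \<le> ennreal (exp \<epsilon>) * emeasure (K S') E"
proof (cases "S = S'")
  case True
  then show ?thesis using \<epsilon> mult_right_mono[of 1 "ennreal (exp \<epsilon>)" "emeasure (K S') E"] by simp
next
  case False
  then obtain i where i: "S i \<noteq> S' i" by auto
  then have "i < n" using S by (force simp: space_PiM PiE_iff extensional_def)
  obtain j where j: "\<forall>i<n. i \<noteq> j \<longrightarrow> S i = S' i" using near by (auto simp: near_def)
  have "\<exists>!i. i < n \<and> S i \<noteq> S' i"
    using i \<open>i < n\<close> j by metis
  then have *: "measure (K S) E \<le> exp \<epsilon> * measure (K S') E"
    using dp S E by (auto simp: differentially_private_def)
  interpret A: prob_space "K S" by (rule prob_kernelD[OF K S(1)])
  interpret B: prob_space "K S'" by (rule prob_kernelD[OF K S(2)])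
  show ?thesis using *
    by (simp add: A.emeasure_eq_measure B.emeasure_eq_measure ennreal_mult[symmetric])
qed

lemma differentially_privateI:
  assumes K: "K \<in> samples Z n \<rightarrow>\<^sub>M prob_algebra Y"
    and le: "\<And>S S' E. S \<in> space (samples Z n) \<Longrightarrow> S' \<in> space (samples Z n) \<Longrightarrow> near n S S' \<Longrightarrow> E \<in> sets Y \<Longrightarrow>
      emeasure (K S) E \<le> ennreal (exp \<epsilon>) * emeasure (K S') E"
  shows "differentially_private Z Y n \<epsilon> K"
  unfolding differentially_private_def
proof (intro ballI impI)
  fix S S' E assume S: "S \<in> space (samples Z n)" "S' \<in> space (samples Z n)" and E: "E \<in> sets Y"
    and "\<exists>!i. i < n \<and> S i \<noteq> S' i"
  then have "near n S S'" unfolding near_def by metis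
  interpret A: prob_space "K S" by (rule prob_kernelD[OF K S(1)])
  interpret B: prob_space "K S'" by (rule prob_kernelD[OF K S(2)])
  show "measure (K S) E \<le> exp \<epsilon> * measure (K S') E"
    using le[OF S \<open>near n S S'\<close> E]
    by (simp add: A.emeasure_eq_measure B.emeasure_eq_measure ennreal_mult[symmetric])
qed

section \<open>Splitting an i.i.d. sample into independent blocks\<close>

definition block :: "nat \<Rightarrow> nat \<Rightarrow> (nat \<Rightarrow> 'z) \<Rightarrow> nat \<Rightarrow> 'z" where
  "block a n S = (\<lambda>i\<in>{..<n}. S (a + i))"

definition append_samples :: "nat \<Rightarrow> nat \<Rightarrow> (nat \<Rightarrow> 'z) \<Rightarrow> (nat \<Rightarrow> 'z) \<Rightarrow> nat \<Rightarrow> 'z" where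
  "append_samples n m S T = (\<lambda>i\<in>{..<n + m}. if i < n then S i else T (i - n))"

lemma measurable_block [measurable]:
  assumes "a + n \<le> N"
  shows "block a n \<in> samples Z N \<rightarrow>\<^sub>M samples Z n"
  unfolding block_def
  using assms by (intro measurable_restrict measurable_component_singleton) auto

lemma measurable_append_samples [measurable]:
  "(\<lambda>(S, T). append_samples n m S T) \<in> samples Z n \<Otimes>\<^sub>M samples Z m \<rightarrow>\<^sub>M samples Z (n + m)"
  unfolding append_samples_def split_beta
proof (rule measurable_restrict)
  fix i assume "i \<in> {..<n + m}"
  then show "(\<lambda>x. if i < n then fst x i else snd x (i - n)) \<in> samples Z n \<Otimes>\<^sub>M samples Z m \<rightarrow>\<^sub>M Z"
    by (cases "i < n") (auto intro!: measurable_compose[OF measurable_fst measurable_component_singleton]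
       measurable_compose[OF measurable_snd measurable_component_singleton])
qed

lemma block_append:
  assumes "S \<in> space (samples Z n)" "T \<in> space (samples Z m)"
  shows "block 0 n (append_samples n m S T) = S" "block n m (append_samples n m S T) = T"
  using assms by (auto simp: block_def append_samples_def space_PiM PiE_iff extensional_def fun_eq_iff)

text \<open>The last claim carries the privacy of composition: the single changed index falls into
  only one of the two blocks.\<close>

lemma near_block:
  assumes "near (n + m) S S'"
  shows "near n (block 0 n S) (block 0 n S')" "near m (block n m S) (block n m S')"
    "block 0 n S = block 0 n S' \<or> block n m S = block n m S'"
proof -
  obtain j where j: "\<And>i. i < n + m \<Longrightarrow> i \<noteq> j \<Longrightarrow> S i = S' i" using assms by (auto simp: near_def)
  show "near n (block 0 n S) (block 0 n S')"
    unfolding near_def by (rule exI[of _ j]) (auto simp: block_def j)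
  show "near m (block n m S) (block n m S')"
    \<comment> \<open>For j < n the truncated difference is 0, which merely exempts one index of a
      block on which the samples agree anyway.\<close>
    unfolding near_def by (rule exI[of _ "j - n"]) (auto simp: block_def intro!: j)
  show "block 0 n S = block 0 n S' \<or> block n m S = block n m S'"
    by (cases "j < n") (auto simp: block_def fun_eq_iff intro!: j)
qed

text \<open>A product measure is determined by its values on boxes, and the preimage of a box under
  concatenation is a product of two boxes.\<close>

lemma distr_append_samples:
  assumes "prob_space D"
  shows "distr (samples D n \<Otimes>\<^sub>M samples D m) (samples D (n + m)) (\<lambda>(S, T). append_samples n m S T)
    = samples D (n + m)"
proof -
  interpret D: prob_space D by fact
  interpret product_sigma_finite "\<lambda>_::nat. D" by standard
  interpret m: prob_space "samples D m" by (rule prob_space_samples) fact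
  show ?thesis
  proof (rule PiM_eqI)
    fix A :: "nat \<Rightarrow> 'a set" assume A: "\<And>i. i \<in> {..<n + m} \<Longrightarrow> A i \<in> sets D"
    have A': "A i \<subseteq> space D" if "i < n + m" for i using sets.sets_into_space[OF A[of i]] that by auto
    have "(\<lambda>(S, T). append_samples n m S T) -` Pi\<^sub>E {..<n+m} A \<inter> space (samples D n \<Otimes>\<^sub>M samples D m)
      = Pi\<^sub>E {..<n} A \<times> Pi\<^sub>E {..<m} (\<lambda>i. A (n + i))" (is "?L = ?R")
    proof (intro set_eqI iffI)
      fix x assume x: "x \<in> ?L"
      obtain S T where ST: "x = (S, T)" by force
      have *: "append_samples n m S T i \<in> A i" if "i < n + m" for i using x ST that by auto
      have "S i \<in> A i" if "i < n" for i using *[of i] that by (auto simp: append_samples_def)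
      moreover have "T i \<in> A (n + i)" if "i < m" for i using *[of "n + i"] that by (auto simp: append_samples_def)
      ultimately show "x \<in> ?R" using x by (auto simp: ST space_pair_measure space_PiM PiE_iff)
    next
      fix x assume x: "x \<in> ?R"
      obtain S T where ST: "x = (S, T)" by force
      have 1: "S i \<in> A i" if "i < n" for i using x ST that by auto
      have 2: "T i \<in> A (n + i)" if "i < m" for i using x ST that by auto
      have "T (i - n) \<in> A i" if "i < n + m" "\<not> i < n" for i using 2[of "i - n"] that by auto
      then have "append_samples n m S T i \<in> A i" if "i < n + m" for i
        using 1 that by (auto simp: append_samples_def)
      moreover have "append_samples n m S T \<in> extensional {..<n + m}"
        by (simp add: append_samples_def)
      ultimately have "append_samples n m S T \<in> Pi\<^sub>E {..<n + m} A"
        unfolding PiE_iff by blast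
      moreover have "S i \<in> space D" if "i < n" for i
        using 1[OF that] A'[of i] that by auto
      moreover have "T i \<in> space D" if "i < m" for i
        using 2[OF that] A'[of "n + i"] that by auto
      moreover have "S \<in> extensional {..<n}" "T \<in> extensional {..<m}"
        using x by (auto simp: ST PiE_iff)
      ultimately show "x \<in> ?L" by (simp add: ST space_pair_measure space_PiM PiE_iff)
    qed
    then have "emeasure (distr (samples D n \<Otimes>\<^sub>M samples D m) (samples D (n + m)) (\<lambda>(S, T). append_samples n m S T)) (Pi\<^sub>E {..<n + m} A)
      = emeasure (samples D n \<Otimes>\<^sub>M samples D m) (Pi\<^sub>E {..<n} A \<times> Pi\<^sub>E {..<m} (\<lambda>i. A (n + i)))"
      using A by (subst emeasure_distr) (auto intro!: sets_PiM_I_finite)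
    also have "\<dots> = (\<Prod>i<n. emeasure D (A i)) * (\<Prod>i<m. emeasure D (A (n + i)))"
    proof -
      have "emeasure (samples D n) (Pi\<^sub>E {..<n} A) = (\<Prod>i<n. emeasure D (A i))"
        using A assms by (intro emeasure_samples_PiE) auto
      moreover have "emeasure (samples D m) (Pi\<^sub>E {..<m} (\<lambda>i. A (n + i))) = (\<Prod>i<m. emeasure D (A (n + i)))"
        using A assms by (intro emeasure_samples_PiE) auto
      ultimately show ?thesis
        using A by (subst m.emeasure_pair_measure_Times) (auto intro!: sets_PiM_I_finite)
    qed
    also have "\<dots> = (\<Prod>i<n + m. emeasure D (A i))"
      by (induction m) (auto simp: mult.assoc[symmetric])
    finally show "emeasure (distr (samples D n \<Otimes>\<^sub>M samples D m) (samples D (n + m)) (\<lambda>(S, T). append_samples n m S T)) (Pi\<^sub>E {..<n + m} A) = (\<Prod>i<n + m. emeasure D (A i))" .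
  qed auto
qed

lemma nn_integral_append_samples:
  assumes D: "prob_space D" and f: "f \<in> borel_measurable (samples D (n + m))"
  shows "(\<integral>\<^sup>+S. f S \<partial>samples D (n + m)) = (\<integral>\<^sup>+S. \<integral>\<^sup>+T. f (append_samples n m S T) \<partial>samples D m \<partial>samples D n)"
proof -
  interpret m: prob_space "samples D m" by (rule prob_space_samples) fact
  note [measurable] = f
  have "(\<integral>\<^sup>+S. f S \<partial>samples D (n + m)) = (\<integral>\<^sup>+p. f (case p of (S, T) \<Rightarrow> append_samples n m S T) \<partial>(samples D n \<Otimes>\<^sub>M samples D m))"
    by (subst distr_append_samples[OF D, symmetric], subst nn_integral_distr) auto
  also have "\<dots> = (\<integral>\<^sup>+S. \<integral>\<^sup>+T. f (append_samples n m S T) \<partial>samples D m \<partial>samples D n)"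
    by (subst m.nn_integral_fst[symmetric]) auto
  finally show ?thesis .
qed

section \<open>Adaptive composition of two mechanisms on disjoint blocks\<close>

text \<open>The second stage may depend on the first output. This covers both uses: collecting the
  outputs of two learners into a pair, and selecting from that pair.\<close>

definition par_comp ::
  "nat \<Rightarrow> nat \<Rightarrow> ((nat \<Rightarrow> 'z) \<Rightarrow> 'y measure) \<Rightarrow> ('y \<Rightarrow> (nat \<Rightarrow> 'z) \<Rightarrow> 'w measure) \<Rightarrow> (nat \<Rightarrow> 'z) \<Rightarrow> 'w measure"
where
  "par_comp n m K L S = K (block 0 n S) \<bind> (\<lambda>y. L y (block n m S))"

context
  fixes Z :: "'z measure" and Y :: "'y measure" and Y' :: "'w measure" and n m :: nat and K L
  assumes K: "K \<in> samples Z n \<rightarrow>\<^sub>M prob_algebra Y"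
    and L: "(\<lambda>(y, T). L y T) \<in> Y \<Otimes>\<^sub>M samples Z m \<rightarrow>\<^sub>M prob_algebra Y'"
begin

lemma measurable_par_comp: "par_comp n m K L \<in> samples Z (n + m) \<rightarrow>\<^sub>M prob_algebra Y'"
proof -
  note [measurable] = K
  have [measurable]: "block 0 n \<in> samples Z (n + m) \<rightarrow>\<^sub>M samples Z n" "block n m \<in> samples Z (n + m) \<rightarrow>\<^sub>M samples Z m"
    by auto
  show ?thesis
    unfolding par_comp_def
    using measurable_compose[OF _ L, of "\<lambda>x. (snd x, block n m (fst x))" "samples Z (n + m) \<Otimes>\<^sub>M Y"]
    by (intro measurable_bind_prob_space2[where N=Y]) (simp_all add: split_beta)
qed

lemma emeasure_par_comp:
  assumes S: "S \<in> space (samples Z (n + m))" and E: "E \<in> sets Y'"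
  shows "emeasure (par_comp n m K L S) E = (\<integral>\<^sup>+y. emeasure (L y (block n m S)) E \<partial>K (block 0 n S))"
proof -
  have b: "block 0 n S \<in> space (samples Z n)" "block n m S \<in> space (samples Z m)"
    using S by (auto intro: measurable_space[OF measurable_block[where N="n + m"]])
  have "(\<lambda>y. L y (block n m S)) \<in> Y \<rightarrow>\<^sub>M prob_algebra Y'"
    using measurable_compose[OF _ L, of "\<lambda>y. (y, block n m S)"] b by simp
  then show ?thesis
    unfolding par_comp_def using measurable_space[OF K b(1)] E
    by (intro emeasure_bind_prob_algebra)
qed

text \<open>Parallel composition costs nothing. If the second blocks agree, the integrand is fixed
  and only the law of y changes, by a factor at most exp \<epsilon>; if the first blocks agree, that
  law is fixed and the integrand changes pointwise by at most this factor.\<close>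

lemma differentially_private_par_comp:
  assumes dpK: "differentially_private Z Y n \<epsilon> K"
    and dpL: "\<And>y. y \<in> space Y \<Longrightarrow> differentially_private Z Y' m \<epsilon> (L y)" and "\<epsilon> \<ge> 0"
  shows "differentially_private Z Y' (n + m) \<epsilon> (par_comp n m K L)"
proof (rule differentially_privateI[OF measurable_par_comp])
  fix S S' E
  assume S: "S \<in> space (samples Z (n + m))" "S' \<in> space (samples Z (n + m))" and near: "near (n + m) S S'"
    and E: "E \<in> sets Y'"
  have b: "block 0 n S \<in> space (samples Z n)" "block n m S \<in> space (samples Z m)" 
     "block 0 n S' \<in> space (samples Z n)" "block n m S' \<in> space (samples Z m)"
    using S by (auto intro: measurable_space[OF measurable_block[where N="n + m"]])
  have Lm: "L y \<in> samples Z m \<rightarrow>\<^sub>M prob_algebra Y'" if "y \<in> space Y" for y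
    using measurable_compose[OF _ L, of "\<lambda>T. (y, T)"] that by simp
  have Em: "(\<lambda>y. emeasure (L y T) E) \<in> borel_measurable Y" if "T \<in> space (samples Z m)" for T
    using measurable_compose[OF _ L, of "\<lambda>y. (y, T)"] that E
    by (intro measurable_emeasure_kernel[OF measurable_prob_algebraD]) auto
  note KS = prob_kernelD[OF K b(1)] and KS' = prob_kernelD[OF K b(3)]
  note nb = near_block[OF near]
  consider "block n m S = block n m S'" | "block 0 n S = block 0 n S'" using nb(3) by blast
  then have "(\<integral>\<^sup>+y. emeasure (L y (block n m S)) E \<partial>K (block 0 n S))
      \<le> ennreal (exp \<epsilon>) * (\<integral>\<^sup>+y. emeasure (L y (block n m S')) E \<partial>K (block 0 n S'))"
  proof cases
    case 1
    show ?thesis unfolding 1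
    proof (rule nn_integral_le_of_emeasure_le)
      show "sets (K (block 0 n S)) = sets (K (block 0 n S'))" by (simp add: KS KS')
      show "(\<lambda>y. emeasure (L y (block n m S')) E) \<in> borel_measurable (K (block 0 n S'))"
        using Em[OF b(4)] by (simp only: measurable_cong_sets[OF KS'(2) refl])
      show "emeasure (K (block 0 n S)) F \<le> ennreal (exp \<epsilon>) * emeasure (K (block 0 n S')) F"
        if "F \<in> sets (K (block 0 n S'))" for F
        using that by (intro differentially_private_emeasure_le[OF dpK K b(1,3) nb(1) \<open>\<epsilon> \<ge> 0\<close>]) (simp add: KS')
    qed
  next
    case 2
    have "(\<integral>\<^sup>+y. emeasure (L y (block n m S)) E \<partial>K (block 0 n S)) \<le> 
       (\<integral>\<^sup>+y. ennreal (exp \<epsilon>) * emeasure (L y (block n m S')) E \<partial>K (block 0 n S))"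
      by (intro nn_integral_mono differentially_private_emeasure_le[OF dpL Lm b(2,4) nb(2) \<open>\<epsilon> \<ge> 0\<close> E]) (simp_all add: KS)
    also have "\<dots> = ennreal (exp \<epsilon>) * (\<integral>\<^sup>+y. emeasure (L y (block n m S')) E \<partial>K (block 0 n S'))"
      unfolding 2 using Em[OF b(4)]
      by (intro nn_integral_cmult) (simp only: measurable_cong_sets[OF KS'(2) refl])
    finally show ?thesis .
  qed
  then show "emeasure (par_comp n m K L S) E \<le> ennreal (exp \<epsilon>) * emeasure (par_comp n m K L S') E"
    by (simp add: emeasure_par_comp S E)
qed

text \<open>The second sample is independent of the intermediate output, so it can be integrated first.\<close>

lemma nn_integral_par_comp:
  assumes D: "prob_space D" "sets D = sets Z" and E: "E \<in> sets Y'"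
  shows "(\<integral>\<^sup>+S. emeasure (par_comp n m K L S) E \<partial>samples D (n + m))
    = (\<integral>\<^sup>+S. \<integral>\<^sup>+y. \<integral>\<^sup>+T. emeasure (L y T) E \<partial>samples D m \<partial>K S \<partial>samples D n)"
proof -
  have sets: "sets (samples D k) = sets (samples Z k)" for k
    by (intro sets_PiM_cong refl D(2))
  note space = sets_eq_imp_space_eq[OF sets]
  interpret m: prob_space "samples D m" by (rule prob_space_samples) fact
  have LE: "(\<lambda>(y, T). emeasure (L y T) E) \<in> borel_measurable (Y \<Otimes>\<^sub>M samples Z m)"
    using measurable_emeasure_kernel[OF measurable_prob_algebraD[OF L] E] unfolding split_beta .
  have meas: "(\<lambda>S. emeasure (par_comp n m K L S) E) \<in> borel_measurable (samples D (n + m))"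
    using measurable_emeasure_kernel[OF measurable_prob_algebraD[OF measurable_par_comp] E]
    unfolding measurable_cong_sets[OF sets refl] .
  have app: "append_samples n m S T \<in> space (samples Z (n + m))"
    if "S \<in> space (samples D n)" "T \<in> space (samples D m)" for S T
    using measurable_space[OF measurable_append_samples[of n m Z], of "(S, T)"] that
    by (simp add: space_pair_measure space)
  have "(\<integral>\<^sup>+S. emeasure (par_comp n m K L S) E \<partial>samples D (n + m))
    = (\<integral>\<^sup>+S. \<integral>\<^sup>+T. emeasure (par_comp n m K L (append_samples n m S T)) E \<partial>samples D m \<partial>samples D n)"
    by (rule nn_integral_append_samples[OF D(1) meas])
  also have "\<dots> = (\<integral>\<^sup>+S. \<integral>\<^sup>+T. \<integral>\<^sup>+y. emeasure (L y T) E \<partial>K S \<partial>samples D m \<partial>samples D n)"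
    by (intro nn_integral_cong) (simp only: emeasure_par_comp[OF app E] block_append)
  also have "\<dots> = (\<integral>\<^sup>+S. \<integral>\<^sup>+y. \<integral>\<^sup>+T. emeasure (L y T) E \<partial>samples D m \<partial>K S \<partial>samples D n)"
  proof (rule nn_integral_cong)
    fix S assume "S \<in> space (samples D n)"
    then have "S \<in> space (samples Z n)" by (simp add: space)
    note KS = prob_kernelD[OF K this]
    interpret KS: prob_space "K S" by (rule KS)
    interpret pair_sigma_finite "K S" "samples D m" ..
    have "sets (K S \<Otimes>\<^sub>M samples D m) = sets (Y \<Otimes>\<^sub>M samples Z m)"
      by (rule sets_pair_measure_cong[OF KS(2) sets])
    then have "(\<lambda>(y, T). emeasure (L y T) E) \<in> borel_measurable (K S \<Otimes>\<^sub>M samples D m)"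
      using LE measurable_cong_sets[OF _ refl, of "K S \<Otimes>\<^sub>M samples D m"] by blast
    then show "(\<integral>\<^sup>+T. \<integral>\<^sup>+y. emeasure (L y T) E \<partial>K S \<partial>samples D m) = (\<integral>\<^sup>+y. \<integral>\<^sup>+T. emeasure (L y T) E \<partial>samples D m \<partial>K S)"
      by (rule Fubini')
  qed
  finally show ?thesis .
qed

end

section \<open>Selection between two hypotheses\<close>

definition excess_errors ::
  "('x \<Rightarrow> bool) set \<Rightarrow> ('x \<Rightarrow> bool) measure \<Rightarrow> ('x \<times> bool) measure \<Rightarrow> real \<Rightarrow> ('x \<Rightarrow> bool) set" where
  "excess_errors H Y D \<alpha> = {h \<in> space Y. \<not> ereal (err h D) \<le> (INF h'\<in>H. ereal (err h' D)) + ereal \<alpha>}"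

text \<open>Failure is a strict inequality against an infimum, so one competitor witnesses it. From
  here on extended reals are avoided; the empty class has no failures.\<close>

lemma excess_errors_iff:
  "h \<in> excess_errors H Y D \<alpha> \<longleftrightarrow> h \<in> space Y \<and> (\<exists>h'\<in>H. err h' D + \<alpha> < err h D)"
proof -
  have "ereal (err h D) \<le> (INF h'\<in>H. ereal (err h' D)) + ereal \<alpha> \<longleftrightarrow>
    ereal (err h D) - ereal \<alpha> \<le> (INF h'\<in>H. ereal (err h' D))"
    by (subst ereal_minus_le) auto
  also have "\<dots> \<longleftrightarrow> (\<forall>h'\<in>H. err h D \<le> err h' D + \<alpha>)"
    by (simp add: le_INF_iff algebra_simps)
  finally show ?thesis by (auto simp: excess_errors_def not_le)
qed

text \<open>The guarantee bounds the probability of failure, written as an integral over the sample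
  of the mass that the kernel gives to the bad outputs. In this form it combines directly with
  Fubini and with products of failure probabilities.\<close>

definition private_learner ::
  "'x measure \<Rightarrow> ('x \<Rightarrow> bool) set \<Rightarrow> ('x \<Rightarrow> bool) measure \<Rightarrow> real \<Rightarrow> nat \<Rightarrow> real \<Rightarrow> real \<Rightarrow>
    ((nat \<Rightarrow> 'x \<times> bool) \<Rightarrow> ('x \<Rightarrow> bool) measure) \<Rightarrow> bool" where
  "private_learner X H Y \<epsilon> n \<alpha> \<beta> K \<longleftrightarrow>
     K \<in> samples (examples X) n \<rightarrow>\<^sub>M prob_algebra Y \<and>
     (\<forall>D. prob_space D \<longrightarrow> sets D = sets (examples X) \<longrightarrow>
        (\<integral>\<^sup>+S. emeasure (K S) (excess_errors H Y D \<alpha>) \<partial>samples D n) \<le> ennreal \<beta>) \<and>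
     differentially_private (examples X) Y n \<epsilon> K"

definition sample_errors :: "nat \<Rightarrow> ('x \<Rightarrow> bool) \<Rightarrow> (nat \<Rightarrow> 'x \<times> bool) \<Rightarrow> real" where
  "sample_errors q h S = (\<Sum>i<q. of_bool (h (fst (S i)) \<noteq> snd (S i)))"

text \<open>The probability of choosing h: with e and e' the error counts of h and h', this is exp
  (- s e) / (exp (- s e) + exp (- s e')), with numerator and denominator divided by exp (- s
  e).\<close>

definition select_weight where
  "select_weight s q h h' S = 1 / (1 + exp (s * (sample_errors q h S - sample_errors q h' S)))"

text \<open>The exponential mechanism on the two candidates, with the number of errors as score.\<close>

definition select_hyp ::
  "('x \<Rightarrow> bool) measure \<Rightarrow> real \<Rightarrow> nat \<Rightarrow> ('x \<Rightarrow> bool) \<times> ('x \<Rightarrow> bool) \<Rightarrow> (nat \<Rightarrow> 'x \<times> bool) \<Rightarrow> ('x \<Rightarrow> bool) measure" where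
  "select_hyp Y s q p S = distr (uniform_measure lborel {0..1::real}) Y
     (\<lambda>u. if u \<le> select_weight s q (fst p) (snd p) S then fst p else snd p)"

lemma select_weight_bounds: "0 < select_weight s q h h' S" "select_weight s q h h' S < 1"
  by (auto simp: select_weight_def add_pos_pos)

lemma select_weight_compl: "1 - select_weight s q h h' S = select_weight s q h' h S"
proof -
  have "1 - 1 / (1 + exp t) = 1 / (1 + exp (- t))" for t :: real
    by (simp add: exp_minus field_simps add_pos_pos less_imp_neq[OF add_pos_pos, symmetric])
  from this[of "s * (sample_errors q h S - sample_errors q h' S)"] show ?thesis
    by (simp add: select_weight_def algebra_simps)
qed

text \<open>Dropping the 1 in the denominator leaves the exponential of a sum over sample points,
  whose expectation factorizes.\<close>

lemma select_weight_le_exp: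
  "select_weight s q h h' S \<le> exp (s * (sample_errors q h' S - sample_errors q h S))"
proof -
  have "1 / (1 + exp t) \<le> exp (- t)" for t :: real
    by (simp add: exp_minus field_simps add_pos_pos)
  from this[of "s * (sample_errors q h S - sample_errors q h' S)"] show ?thesis
    by (simp add: select_weight_def algebra_simps)
qed

lemma sample_errors_near:
  assumes "near q S S'"
  shows "\<bar>sample_errors q h S - sample_errors q h S'\<bar> \<le> 1"
proof -
  obtain j where j: "\<And>i. i < q \<Longrightarrow> i \<noteq> j \<Longrightarrow> S i = S' i" using assms by (auto simp: near_def)
  let ?d = "\<lambda>i. of_bool (h (fst (S i)) \<noteq> snd (S i)) - of_bool (h (fst (S' i)) \<noteq> snd (S' i)) :: real"
  have "sample_errors q h S - sample_errors q h S' = (\<Sum>i<q. ?d i)"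
    by (simp add: sample_errors_def sum_subtractf)
  also have "\<bar>\<dots>\<bar> \<le> (\<Sum>i<q. if i = j then 1 else 0 :: real)"
    by (rule order_trans[OF sum_abs], rule sum_mono) (use j in auto)
  also have "\<dots> \<le> 1" by (simp add: sum.delta)
  finally show ?thesis .
qed

text \<open>One changed point moves each error count by at most 1, hence their difference by at most
  2 and the exponent by at most 2 s \<le> \<epsilon>. The summand 1 in the denominator is absorbed
  because exp \<epsilon> \<ge> 1.\<close>

lemma select_weight_near:
  assumes "near q S S'" and s: "0 \<le> s" "2 * s \<le> \<epsilon>"
  shows "select_weight s q h h' S \<le> exp \<epsilon> * select_weight s q h h' S'"
proof -
  define t t' where "t = s * (sample_errors q h S - sample_errors q h' S)"
    and "t' = s * (sample_errors q h S' - sample_errors q h' S')"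
  have "sample_errors q h S' - sample_errors q h' S' \<le> (sample_errors q h S - sample_errors q h' S) + 2"
    using sample_errors_near[OF assms(1), of h] sample_errors_near[OF assms(1), of h'] by linarith
  from mult_left_mono[OF this s(1)] have "t' \<le> t + \<epsilon>"
    using s by (simp add: t_def t'_def algebra_simps)
  then have "exp t' \<le> exp \<epsilon> * exp t" by (simp add: exp_add[symmetric] add.commute)
  moreover have "1 \<le> exp \<epsilon>" using s by simp
  ultimately have "1 + exp t' \<le> exp \<epsilon> * (1 + exp t)" unfolding distrib_left by linarith
  then show ?thesis
    by (simp add: select_weight_def t_def[symmetric] t'_def[symmetric] field_simps add_pos_pos)
qed

lemma prob_space_unit: "prob_space (uniform_measure lborel {0..1::real})"
  by (rule prob_space_uniform_measure) auto

lemma emeasure_select_hyp: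
  assumes h: "fst p \<in> space Y" "snd p \<in> space Y" and E: "E \<in> sets Y"
  shows "emeasure (select_hyp Y s q p S) E =
    ennreal (select_weight s q (fst p) (snd p) S) * indicator E (fst p) +
    ennreal (select_weight s q (snd p) (fst p) S) * indicator E (snd p)"
proof -
  let ?w = "select_weight s q (fst p) (snd p) S" and ?U = "uniform_measure lborel {0..1::real}"
  note w = select_weight_bounds[of s q "fst p" "snd p" S]
  have 1: "emeasure ?U {..?w} = ennreal ?w"
  proof -
    have "{0..1} \<inter> {..?w} = {0..?w}" using w by auto
    then show ?thesis using w by (simp add: divide_ennreal_def)
  qed
  have 2: "emeasure ?U {?w<..} = ennreal (1 - ?w)"
  proof -
    have "{0..1} \<inter> {?w<..} = {?w<..1}" using w by auto
    then show ?thesis using w by (simp add: divide_ennreal_def)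
  qed
  have 3: "emeasure ?U UNIV = 1" using prob_space.emeasure_space_1[OF prob_space_unit] by simp
  have "emeasure (select_hyp Y s q p S) E = emeasure ?U ((\<lambda>u. if u \<le> ?w then fst p else snd p) -` E)"
    unfolding select_hyp_def using h E by (subst emeasure_distr) auto
  also have "(\<lambda>u. if u \<le> ?w then fst p else snd p) -` E =
    (if fst p \<in> E then (if snd p \<in> E then UNIV else {..?w}) else (if snd p \<in> E then {?w<..} else {}))"
    by (auto split: if_splits)
  also have "emeasure ?U \<dots> = ennreal ?w * indicator E (fst p) + ennreal (1 - ?w) * indicator E (snd p)"
    using w by (auto simp: 1 2 3 ennreal_plus[symmetric] simp del: emeasure_uniform_measure ennreal_plus)
  finally show ?thesis by (simp add: select_weight_compl)
qed

section \<open>Measurability of errors and of the selection mechanism\<close>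

lemma measurable_hypothesis_eval:
  assumes "hypothesis_space X Y"
  shows "(\<lambda>(h, z). h (fst z) \<noteq> snd z) \<in> Y \<Otimes>\<^sub>M examples X \<rightarrow>\<^sub>M count_space UNIV"
proof -
  have [measurable]: "(\<lambda>p. fst p (snd p)) \<in> Y \<Otimes>\<^sub>M X \<rightarrow>\<^sub>M count_space UNIV"
    using assms by (simp add: hypothesis_space_def split_beta)
  have "(\<lambda>p. (fst p) (fst (snd p))) \<in> Y \<Otimes>\<^sub>M examples X \<rightarrow>\<^sub>M count_space UNIV"
    using measurable_compose[of "\<lambda>p. (fst p, fst (snd p))" "Y \<Otimes>\<^sub>M examples X" "Y \<Otimes>\<^sub>M X" "\<lambda>p. fst p (snd p)"]
    by (simp add: examples_def)
  moreover have "(\<lambda>p. snd (snd p)) \<in> Y \<Otimes>\<^sub>M examples X \<rightarrow>\<^sub>M count_space UNIV"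
    by (simp add: examples_def)
  ultimately show ?thesis unfolding split_beta by measurable
qed

lemma measurable_hypothesis:
  assumes "hypothesis_space X Y" "h \<in> space Y" "sets D = sets (examples X)"
  shows "{z \<in> space D. h (fst z) \<noteq> snd z} \<in> sets D"
proof -
  have "(\<lambda>z. h (fst z) \<noteq> snd z) \<in> examples X \<rightarrow>\<^sub>M count_space UNIV"
    using measurable_compose[OF _ measurable_hypothesis_eval[OF assms(1)], of "\<lambda>z. (h, z)" "examples X"] assms(2)
    by simp
  then have "Measurable.pred D (\<lambda>z. h (fst z) \<noteq> snd z)"
    using measurable_cong_sets[OF assms(3) refl] by blast
  then show ?thesis by measurable
qed

text \<open>The error of h is the measure of the section at h of a jointly measurable set.\<close>

lemma measurable_err:
  assumes Y: "hypothesis_space X Y" and D: "prob_space D" "sets D = sets (examples X)"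
  shows "(\<lambda>h. err h D) \<in> borel_measurable Y"
proof -
  interpret prob_space D by fact
  have sets: "sets (Y \<Otimes>\<^sub>M D) = sets (Y \<Otimes>\<^sub>M examples X)" by (rule sets_pair_measure_cong[OF refl D(2)])
  have "(\<lambda>(h, z). h (fst z) \<noteq> snd z) \<in> Y \<Otimes>\<^sub>M D \<rightarrow>\<^sub>M count_space UNIV"
    using measurable_hypothesis_eval[OF Y] measurable_cong_sets[OF sets refl] by blast
  then have "{p \<in> space (Y \<Otimes>\<^sub>M D). case p of (h, z) \<Rightarrow> h (fst z) \<noteq> snd z} \<in> sets (Y \<Otimes>\<^sub>M D)"
    by (rule measurable_sets_Collect) simp
  from measurable_emeasure_Pair[OF this]
  have "(\<lambda>h. measure D (Pair h -` {p \<in> space (Y \<Otimes>\<^sub>M D). case p of (h, z) \<Rightarrow> h (fst z) \<noteq> snd z})) \<in> borel_measurable Y"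
    unfolding measure_def by (rule borel_measurable_enn2real)
  also have "?this \<longleftrightarrow> (\<lambda>h. err h D) \<in> borel_measurable Y"
    unfolding err_def by (intro measurable_cong arg_cong2[where f=measure] refl) (auto simp: space_pair_measure)
  finally show ?thesis .
qed

lemma sets_excess_errors:
  assumes Y: "hypothesis_space X Y" and D: "prob_space D" "sets D = sets (examples X)"
  shows "excess_errors H Y D \<alpha> \<in> sets Y"
proof -
  note [measurable] = measurable_err[OF assms]
  show ?thesis unfolding excess_errors_def by measurable
qed

lemma measurable_sample_errors:
  assumes Y: "hypothesis_space X Y"
  shows "(\<lambda>(h, S). sample_errors q h S) \<in> borel_measurable (Y \<Otimes>\<^sub>M samples (examples X) q)"
  unfolding sample_errors_def split_beta
proof (rule borel_measurable_sum)
  fix i assume "i \<in> {..<q}"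
  then have "(\<lambda>p. (fst p, snd p i)) \<in> Y \<Otimes>\<^sub>M samples (examples X) q \<rightarrow>\<^sub>M Y \<Otimes>\<^sub>M examples X"
    by measurable
  from measurable_compose[OF this measurable_hypothesis_eval[OF Y]]
  have "Measurable.pred (Y \<Otimes>\<^sub>M samples (examples X) q) (\<lambda>p. fst p (fst (snd p i)) \<noteq> snd (snd p i))"
    by simp
  from measurable_compose[OF this, of of_bool borel]
  show "(\<lambda>p. of_bool (fst p (fst (snd p i)) \<noteq> snd (snd p i)) :: real) \<in> borel_measurable (Y \<Otimes>\<^sub>M samples (examples X) q)"
    by simp
qed

lemma measurable_select_weight:
  assumes Y: "hypothesis_space X Y"
  shows "(\<lambda>(p, S). select_weight s q (fst p) (snd p) S) \<in> borel_measurable ((Y \<Otimes>\<^sub>M Y) \<Otimes>\<^sub>M samples (examples X) q)"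
proof -
  note m = measurable_compose[OF _ measurable_sample_errors[OF Y, of q], where M="(Y \<Otimes>\<^sub>M Y) \<Otimes>\<^sub>M samples (examples X) q"]
  have [measurable]: "(\<lambda>x. sample_errors q (fst (fst x)) (snd x)) \<in> borel_measurable ((Y \<Otimes>\<^sub>M Y) \<Otimes>\<^sub>M samples (examples X) q)"
    using m[of "\<lambda>x. (fst (fst x), snd x)"] by simp
  have [measurable]: "(\<lambda>x. sample_errors q (snd (fst x)) (snd x)) \<in> borel_measurable ((Y \<Otimes>\<^sub>M Y) \<Otimes>\<^sub>M samples (examples X) q)"
    using m[of "\<lambda>x. (snd (fst x), snd x)"] by simp
  show ?thesis unfolding select_weight_def split_beta by measurable
qed

text \<open>The mechanism is the image of one fixed uniform variable, so measurability of the kernel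
  reduces to joint measurability of a deterministic map. This is why it is defined through u rather
  than as a sum of two point masses.\<close>

lemma measurable_select_hyp:
  assumes Y: "hypothesis_space X Y"
  shows "(\<lambda>(p, S). select_hyp Y s q p S) \<in> (Y \<Otimes>\<^sub>M Y) \<Otimes>\<^sub>M samples (examples X) q \<rightarrow>\<^sub>M prob_algebra Y"
proof -
  let ?M = "(Y \<Otimes>\<^sub>M Y) \<Otimes>\<^sub>M samples (examples X) q"
  have [measurable]: "(\<lambda>x. select_weight s q (fst (fst x)) (snd (fst x)) (snd x)) \<in> borel_measurable ?M"
    using measurable_select_weight[OF Y] by (simp add: split_beta)
  have "uniform_measure lborel {0..1::real} \<in> space (prob_algebra borel)"
    by (simp add: space_prob_algebra prob_space_unit)
  then have U: "(\<lambda>x. uniform_measure lborel {0..1::real}) \<in> ?M \<rightarrow>\<^sub>M prob_algebra borel"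
    by simp
  show ?thesis unfolding select_hyp_def split_beta
  proof (rule measurable_distr_prob_space2[OF U])
    show "(\<lambda>(x, u). if u \<le> select_weight s q (fst (fst x)) (snd (fst x)) (snd x) then fst (fst x) else snd (fst x))
      \<in> ?M \<Otimes>\<^sub>M borel \<rightarrow>\<^sub>M Y"
      unfolding split_beta by measurable
  qed
qed

lemma differentially_private_select_hyp:
  assumes Y: "hypothesis_space X Y" and p: "p \<in> space (Y \<Otimes>\<^sub>M Y)" and s: "0 \<le> s" "2 * s \<le> \<epsilon>"
  shows "differentially_private (examples X) Y q \<epsilon> (select_hyp Y s q p)"
proof (rule differentially_privateI)
  show "select_hyp Y s q p \<in> samples (examples X) q \<rightarrow>\<^sub>M prob_algebra Y"
    using measurable_compose[OF _ measurable_select_hyp[OF Y], of "\<lambda>S. (p, S)"] p by simp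
next
  fix S S' :: "nat \<Rightarrow> 'a \<times> bool" and E assume near: "near q S S'" and E: "E \<in> sets Y"
  have h: "fst p \<in> space Y" "snd p \<in> space Y" using p by (auto simp: space_pair_measure)
  have w: "ennreal (select_weight s q h h' S) \<le> ennreal (exp \<epsilon>) * ennreal (select_weight s q h h' S')" for h h'
    using select_weight_near[OF near s, of h h'] by (simp add: ennreal_mult'[symmetric] ennreal_leI)
  show "emeasure (select_hyp Y s q p S) E \<le> ennreal (exp \<epsilon>) * emeasure (select_hyp Y s q p S') E"
    unfolding emeasure_select_hyp[OF h E] distrib_left mult.assoc[symmetric]
    by (intro add_mono mult_right_mono w) auto
qed

section \<open>Failure probability of the selection\<close>

text \<open>The product (1 - s + s^2)(1 + s) equals 1 + s^3 \<ge> 1, and 1 + s \<le> exp s.\<close>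

lemma exp_uminus_le_quadratic:
  fixes s :: real assumes "0 \<le> s"
  shows "exp (- s) \<le> 1 - s + s\<^sup>2"
proof -
  have "1 \<le> (1 - s + s\<^sup>2) * (1 + s)" using assms by (simp add: algebra_simps power2_eq_square)
  also have "\<dots> \<le> (1 - s + s\<^sup>2) * exp s"
  proof (rule mult_left_mono)
    show "0 \<le> 1 - s + s\<^sup>2"
      using zero_le_power2[of "s - 1/2"] by (simp add: power2_eq_square algebra_simps)
  qed simp
  finally show ?thesis by (simp add: exp_minus field_simps)
qed

text \<open>A Chernoff argument. The exponential factorizes over the points; at one point the
  difference d of the two error indicators has mean at most - \<delta>, so its factor is at most 1 -
  s \<delta> + s^2 \<le> 1 - s \<delta> / 2, using s \<le> \<delta> / 2.\<close>

lemma nn_integral_exp_sample_errors: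
  assumes Y: "hypothesis_space X Y" and D: "prob_space D" "sets D = sets (examples X)"
    and h: "h \<in> space Y" "h' \<in> space Y" and gap: "err h D + \<delta> \<le> err h' D"
    and s: "0 \<le> s" "s \<le> 1" "s \<le> \<delta> / 2"
  shows "(\<integral>\<^sup>+S. ennreal (exp (s * (sample_errors q h S - sample_errors q h' S))) \<partial>samples D q)
    \<le> ennreal ((1 - s * \<delta> / 2) ^ q)"
proof -
  interpret prob_space D by fact
  interpret product_sigma_finite "\<lambda>_::nat. D" by standard
  define A where "A h = {z \<in> space D. h (fst z) \<noteq> snd z}" for h
  have A [measurable]: "A h \<in> sets D" "A h' \<in> sets D"
    unfolding A_def using measurable_hypothesis[OF Y _ D(2)] h by auto
  define d where "d z = indicator (A h) z - (indicator (A h') z :: real)" for z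
  have [measurable]: "d \<in> borel_measurable D" unfolding d_def by measurable
  have intA: "integrable D (indicator (A h) :: _ \<Rightarrow> real)" "integrable D (indicator (A h') :: _ \<Rightarrow> real)"
    by (auto intro!: integrable_real_indicator simp: emeasure_eq_measure)
  have intd: "integrable D d" unfolding d_def using intA by (intro Bochner_Integration.integrable_diff)
  have Ed: "(\<integral>z. d z \<partial>D) \<le> - \<delta>"
  proof -
    have "A h \<inter> space D = A h" "A h' \<inter> space D = A h'" by (auto simp: A_def)
    moreover have "err h D = prob (A h)" "err h' D = prob (A h')" by (auto simp: err_def A_def)
    ultimately show ?thesis using gap intA by (simp add: d_def)
  qed
  \<comment> \<open>The values of d are 1, 0 and -1; the last one is the quadratic bound proved
    above.\<close>
  have *: "exp (s * d z) \<le> 1 + s * d z + s\<^sup>2" for z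
    using exp_bound[of s] exp_uminus_le_quadratic[of s] s by (auto simp: d_def indicator_def)
  have pos: "0 \<le> 1 + s * d z + s\<^sup>2" for z using *[of z] by (rule order_trans[rotated]) simp
  have "(\<integral>\<^sup>+z. ennreal (exp (s * d z)) \<partial>D) \<le> (\<integral>\<^sup>+z. ennreal (1 + s * d z + s\<^sup>2) \<partial>D)"
    using * by (intro nn_integral_mono ennreal_leI)
  also have "\<dots> = ennreal (\<integral>z. 1 + s * d z + s\<^sup>2 \<partial>D)"
    using intd pos by (intro nn_integral_eq_integral) auto
  also have "(\<integral>z. 1 + s * d z + s\<^sup>2 \<partial>D) = 1 + s * (\<integral>z. d z \<partial>D) + s\<^sup>2"
    using intd by (simp add: prob_space)
  also have "\<dots> \<le> 1 - s * \<delta> / 2"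
    using mult_left_mono[OF Ed s(1)] mult_left_mono[OF s(3,1)] by (simp add: power2_eq_square)
  finally have le: "(\<integral>\<^sup>+z. ennreal (exp (s * d z)) \<partial>D) \<le> ennreal (1 - s * \<delta> / 2)"
    by (auto simp: ennreal_leI)
  have "(\<integral>\<^sup>+S. ennreal (exp (s * (sample_errors q h S - sample_errors q h' S))) \<partial>samples D q) =
    (\<integral>\<^sup>+S. (\<Prod>i<q. ennreal (exp (s * d (S i)))) \<partial>samples D q)"
  proof (rule nn_integral_cong)
    fix S assume "S \<in> space (samples D q)"
    then have "sample_errors q h S - sample_errors q h' S = (\<Sum>i<q. d (S i))"
      unfolding sample_errors_def sum_subtractf[symmetric]
      by (intro sum.cong) (auto simp: d_def A_def indicator_def space_PiM)
    then show "ennreal (exp (s * (sample_errors q h S - sample_errors q h' S))) = (\<Prod>i<q. ennreal (exp (s * d (S i))))"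
      by (simp add: prod_ennreal exp_sum[symmetric] sum_distrib_left)
  qed
  also have "\<dots> = (\<Prod>i<q. \<integral>\<^sup>+z. ennreal (exp (s * d z)) \<partial>D)"
    by (rule product_nn_integral_prod) auto
  also have "\<dots> = (\<integral>\<^sup>+z. ennreal (exp (s * d z)) \<partial>D) ^ q" by simp
  also have "\<dots> \<le> ennreal (1 - s * \<delta> / 2) ^ q"
    by (rule power_mono[OF le]) simp
  also have "\<dots> = ennreal ((1 - s * \<delta> / 2) ^ q)"
  proof (rule ennreal_power)
    \<comment> \<open>The gap of two error rates is at most 1; this keeps the base of the power
      nonnegative, as its passage through \<open>ennreal\<close> requires.\<close>
    have "\<delta> \<le> 1"
    proof -
      have "0 \<le> err h D" "err h' D \<le> 1" by (simp_all add: err_def)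
      with gap show ?thesis by linarith
    qed
    with s show "0 \<le> 1 - s * \<delta> / 2" using mult_mono[of s 1 \<delta> 1] by auto
  qed
  finally show ?thesis .
qed

lemma excess_errorsD:
  assumes "h \<in> space Y" "h \<notin> excess_errors H Y D \<alpha>" "h' \<in> excess_errors H Y D (\<alpha> + \<delta>)"
  shows "err h D + \<delta> < err h' D"
  using assms unfolding excess_errors_iff by force

lemma excess_errors_antimono: "\<alpha> \<le> \<alpha>' \<Longrightarrow> excess_errors H Y D \<alpha>' \<subseteq> excess_errors H Y D \<alpha>"
proof
  fix h assume "\<alpha> \<le> \<alpha>'" "h \<in> excess_errors H Y D \<alpha>'"
  then obtain h' where "h \<in> space Y" "h' \<in> H" "err h' D + \<alpha>' < err h D"
    by (auto simp: excess_errors_iff)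
  with \<open>\<alpha> \<le> \<alpha>'\<close> have "err h' D + \<alpha> < err h D" by linarith
  with \<open>h \<in> space Y\<close> \<open>h' \<in> H\<close> show "h \<in> excess_errors H Y D \<alpha>"
    by (auto simp: excess_errors_iff)
qed

text \<open>The thresholds \<alpha> and \<alpha> + \<delta> create the gap that selection can
  detect: a candidate beyond the larger one is worse by more than \<delta> than a candidate within
  the smaller one. A candidate in between may be chosen safely, so failure needs either two
  candidates beyond \<alpha>, bounded trivially by 1, or a wrong choice across the gap.\<close>

lemma select_hyp_failure:
  assumes Y: "hypothesis_space X Y" and D: "prob_space D" "sets D = sets (examples X)"
    and h: "fst p \<in> space Y" "snd p \<in> space Y"
    and s: "0 \<le> s" "s \<le> 1" "s \<le> \<delta> / 2"
  shows "(\<integral>\<^sup>+S. emeasure (select_hyp Y s q p S) (excess_errors H Y D (\<alpha> + \<delta>)) \<partial>samples D q)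
    \<le> indicator (excess_errors H Y D \<alpha> \<times> excess_errors H Y D \<alpha>) p + ennreal ((1 - s * \<delta> / 2) ^ q)"
    (is "?I \<le> _")
proof -
  let ?B = "excess_errors H Y D \<alpha>" and ?B' = "excess_errors H Y D (\<alpha> + \<delta>)"
  interpret q: prob_space "samples D q" by (rule prob_space_samples) fact
  have E: "?B' \<in> sets Y" by (rule sets_excess_errors) fact+
  have sub: "?B' \<subseteq> ?B" using s by (intro excess_errors_antimono) auto
  have wrong: "(\<integral>\<^sup>+S. ennreal (select_weight s q h' h S) \<partial>samples D q) \<le> ennreal ((1 - s * \<delta> / 2) ^ q)"
    if "h \<in> space Y" "h \<notin> ?B" "h' \<in> ?B'" for h h'
  proof -
    have "h' \<in> space Y" using that by (simp add: excess_errors_def)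
    have "(\<integral>\<^sup>+S. ennreal (select_weight s q h' h S) \<partial>samples D q) \<le>
      (\<integral>\<^sup>+S. ennreal (exp (s * (sample_errors q h S - sample_errors q h' S))) \<partial>samples D q)"
      by (intro nn_integral_mono ennreal_leI select_weight_le_exp)
    also have "\<dots> \<le> ennreal ((1 - s * \<delta> / 2) ^ q)"
      using excess_errorsD[OF that] that
      by (intro nn_integral_exp_sample_errors[OF Y D _ _ _ s] \<open>h' \<in> space Y\<close>) auto
    finally show ?thesis .
  qed
  have I: "?I = (\<integral>\<^sup>+S. ennreal (select_weight s q (fst p) (snd p) S) * indicator ?B' (fst p) +
      ennreal (select_weight s q (snd p) (fst p) S) * indicator ?B' (snd p) \<partial>samples D q)"
    by (simp add: emeasure_select_hyp[OF h E])
  consider "fst p \<in> ?B" "snd p \<in> ?B" | "fst p \<notin> ?B" "snd p \<in> ?B'" | "fst p \<in> ?B'" "snd p \<notin> ?B"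
    | "fst p \<notin> ?B'" "snd p \<notin> ?B'"
    using sub by blast
  then show ?thesis
  proof cases
    case 1
    have "?I \<le> (\<integral>\<^sup>+S. 1 \<partial>samples D q)"
    proof (rule nn_integral_mono)
      fix S
      have "prob_space (select_hyp Y s q p S)"
        unfolding select_hyp_def using h by (intro prob_space.prob_space_distr prob_space_unit) simp
      then show "emeasure (select_hyp Y s q p S) ?B' \<le> 1"
        by (rule prob_space.emeasure_le_1)
    qed
    also have "\<dots> = 1" by (simp add: q.emeasure_space_1)
    also have "\<dots> = indicator (?B \<times> ?B) p" using 1 by (cases p) simp
    finally show ?thesis by (rule order_trans) simp
  next
    case 2
    then have "fst p \<notin> ?B'" using sub by blast
    with 2 have "?I \<le> ennreal ((1 - s * \<delta> / 2) ^ q)"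
      unfolding I using wrong[OF h(1)] by simp
    then show ?thesis by (rule order_trans) simp
  next
    case 3
    then have "snd p \<notin> ?B'" using sub by blast
    with 3 have "?I \<le> ennreal ((1 - s * \<delta> / 2) ^ q)"
      unfolding I using wrong[OF h(2)] by simp
    then show ?thesis by (rule order_trans) simp
  next
    case 4
    then show ?thesis unfolding I by simp
  qed
qed

text \<open>A second stage that carries the first output along; composing with it gives the joint
  law of two candidates.\<close>

lemma measurable_pair_kernel:
  assumes K: "K \<in> M \<rightarrow>\<^sub>M prob_algebra Y'"
  shows "(\<lambda>(y, T). distr (K T) (Y \<Otimes>\<^sub>M Y') (Pair y)) \<in> Y \<Otimes>\<^sub>M M \<rightarrow>\<^sub>M prob_algebra (Y \<Otimes>\<^sub>M Y')"
  unfolding split_beta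
proof (rule measurable_distr_prob_space2)
  show "(\<lambda>x. K (snd x)) \<in> Y \<Otimes>\<^sub>M M \<rightarrow>\<^sub>M prob_algebra Y'"
    using measurable_compose[OF measurable_snd K] .
  show "(\<lambda>(x, y). (fst x, y)) \<in> (Y \<Otimes>\<^sub>M M) \<Otimes>\<^sub>M Y' \<rightarrow>\<^sub>M Y \<Otimes>\<^sub>M Y'"
    unfolding split_beta by measurable
qed

lemma emeasure_distr_kernel:
  assumes "K \<in> M \<rightarrow>\<^sub>M prob_algebra Y" "x \<in> space M" "f \<in> Y \<rightarrow>\<^sub>M N" "E \<in> sets N"
  shows "emeasure (distr (K x) N f) E = emeasure (K x) (f -` E \<inter> space Y)"
proof -
  note K = prob_kernelD[OF assms(1,2)]
  have "f \<in> K x \<rightarrow>\<^sub>M N" using assms(3) measurable_cong_sets[OF K(2) refl] by blast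
  then show ?thesis using assms(4) K(3) by (simp add: emeasure_distr)
qed

text \<open>Post-processing: the preimage of an event is an event.\<close>

lemma differentially_private_distr:
  assumes K: "K \<in> samples Z n \<rightarrow>\<^sub>M prob_algebra Y" and dp: "differentially_private Z Y n \<epsilon> K"
    and f: "f \<in> Y \<rightarrow>\<^sub>M N" and \<epsilon>: "0 \<le> \<epsilon>"
  shows "differentially_private Z N n \<epsilon> (\<lambda>S. distr (K S) N f)"
proof (rule differentially_privateI)
  show "(\<lambda>S. distr (K S) N f) \<in> samples Z n \<rightarrow>\<^sub>M prob_algebra N"
    by (rule measurable_compose[OF K measurable_distr_prob_space[OF f]])
next
  fix S S' E assume S: "S \<in> space (samples Z n)" "S' \<in> space (samples Z n)" "near n S S'" and E: "E \<in> sets N"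
  have "f -` E \<inter> space Y \<in> sets Y" using f E by (rule measurable_sets)
  then show "emeasure (distr (K S) N f) E \<le> ennreal (exp \<epsilon>) * emeasure (distr (K S') N f) E"
    unfolding emeasure_distr_kernel[OF K S(1) f E] emeasure_distr_kernel[OF K S(2) f E]
    by (rule differentially_private_emeasure_le[OF dp K S \<epsilon>])
qed

text \<open>Three disjoint blocks: one for each learner and one for the selection. Independence of
  the first two makes the probability that both candidates are bad at most \<beta> \<beta>'; the
  third block is taken long enough for a wrong selection to cost at most \<gamma>.\<close>

lemma private_learner_select:
  assumes Y: "hypothesis_space X Y" and \<epsilon>: "0 < \<epsilon>" and \<delta>: "0 < \<delta>" and \<gamma>: "0 < \<gamma>" and \<beta>: "0 \<le> \<beta>" "0 \<le> \<beta>'"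
    and 1: "private_learner X H Y \<epsilon> n \<alpha> \<beta> K" and 2: "private_learner X H Y \<epsilon> n' \<alpha> \<beta>' K'"
  shows "\<exists>N L. private_learner X H Y \<epsilon> N (\<alpha> + \<delta>) (\<beta> * \<beta>' + \<gamma>) L"
proof -
  have K: "K \<in> samples (examples X) n \<rightarrow>\<^sub>M prob_algebra Y" and dpK: "differentially_private (examples X) Y n \<epsilon> K"
    using 1 by (auto simp: private_learner_def)
  have K': "K' \<in> samples (examples X) n' \<rightarrow>\<^sub>M prob_algebra Y" and dpK': "differentially_private (examples X) Y n' \<epsilon> K'"
    using 2 by (auto simp: private_learner_def)
  \<comment> \<open>The bound \<epsilon> / 2 gives privacy of the selection and \<delta> / 2 the
    Chernoff bound. The last one yields s + s \<delta> \<le> 1, hence both s \<le> 1 and s \<delta>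
    \<le> 1.\<close>
  define s where "s = Min {\<epsilon> / 2, \<delta> / 2, 1 / (1 + \<delta>)}"
  have s: "0 < s" "s \<le> \<delta> / 2" "2 * s \<le> \<epsilon>" "s \<le> 1 / (1 + \<delta>)" using \<epsilon> \<delta> by (auto simp: s_def)
  then have "s * (1 + \<delta>) \<le> 1" using \<delta> by (simp add: field_simps)
  moreover have "0 < s * \<delta>" using s \<delta> by simp
  ultimately have s': "s \<le> 1" "s * \<delta> \<le> 1" using s(1) unfolding distrib_left by linarith+
  obtain q where q: "(1 - s * \<delta> / 2) ^ q < \<gamma>"
    using real_arch_pow_inv[OF \<gamma>, of "1 - s * \<delta> / 2"] s' \<open>0 < s * \<delta>\<close> by auto
  define P where "P = par_comp n n' K (\<lambda>h T. distr (K' T) (Y \<Otimes>\<^sub>M Y) (Pair h))"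
  define L where "L = par_comp (n + n') q P (select_hyp Y s q)"
  note pair = measurable_pair_kernel[OF K', of Y]
  have P: "P \<in> samples (examples X) (n + n') \<rightarrow>\<^sub>M prob_algebra (Y \<Otimes>\<^sub>M Y)"
    unfolding P_def by (rule measurable_par_comp[OF K pair])
  note sel = measurable_select_hyp[OF Y, of s q]
  have dpP: "differentially_private (examples X) (Y \<Otimes>\<^sub>M Y) (n + n') \<epsilon> P"
    unfolding P_def using \<epsilon> by (intro differentially_private_par_comp[OF K pair dpK] differentially_private_distr[OF K' dpK']) auto
  have dpL: "differentially_private (examples X) Y (n + n' + q) \<epsilon> L"
    unfolding L_def using \<epsilon> s by (intro differentially_private_par_comp[OF P sel dpP] differentially_private_select_hyp[OF Y]) auto
  have L: "L \<in> samples (examples X) (n + n' + q) \<rightarrow>\<^sub>M prob_algebra Y"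
    unfolding L_def by (rule measurable_par_comp[OF P sel])
  have "(\<integral>\<^sup>+S. emeasure (L S) (excess_errors H Y D (\<alpha> + \<delta>)) \<partial>samples D (n + n' + q)) \<le> ennreal (\<beta> * \<beta>' + \<gamma>)"
    if D: "prob_space D" "sets D = sets (examples X)" for D
  proof -
    let ?B = "excess_errors H Y D \<alpha>"
    have sets: "sets (samples D k) = sets (samples (examples X) k)" for k
      by (intro sets_PiM_cong refl D(2))
    note space = sets_eq_imp_space_eq[OF sets]
    note meas = sets_excess_errors[OF Y D, of H]
    interpret nn: prob_space "samples D (n + n')" by (rule prob_space_samples) fact
    have \<beta>': "(\<integral>\<^sup>+S. emeasure (K' S) ?B \<partial>samples D n') \<le> ennreal \<beta>'"
      using 2 D by (auto simp: private_learner_def)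
    have "(\<integral>\<^sup>+S. emeasure (L S) (excess_errors H Y D (\<alpha> + \<delta>)) \<partial>samples D (n + n' + q)) =
      (\<integral>\<^sup>+S. \<integral>\<^sup>+p. \<integral>\<^sup>+T. emeasure (select_hyp Y s q p T) (excess_errors H Y D (\<alpha> + \<delta>)) \<partial>samples D q \<partial>P S \<partial>samples D (n + n'))"
      unfolding L_def by (rule nn_integral_par_comp[OF P sel D meas])
    also have "\<dots> \<le> (\<integral>\<^sup>+S. emeasure (P S) (?B \<times> ?B) + ennreal \<gamma> \<partial>samples D (n + n'))"
    proof (rule nn_integral_mono)
      fix S assume "S \<in> space (samples D (n + n'))"
      then have S: "S \<in> space (samples (examples X) (n + n'))" by (simp add: space)
      note PS = prob_kernelD[OF P S]
      interpret PS: prob_space "P S" by (rule PS)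
      have "(\<integral>\<^sup>+p. \<integral>\<^sup>+T. emeasure (select_hyp Y s q p T) (excess_errors H Y D (\<alpha> + \<delta>)) \<partial>samples D q \<partial>P S)
        \<le> (\<integral>\<^sup>+p. indicator (?B \<times> ?B) p + ennreal \<gamma> \<partial>P S)"
      proof (rule nn_integral_mono)
        fix p assume "p \<in> space (P S)"
        then have p: "fst p \<in> space Y" "snd p \<in> space Y" by (auto simp: PS space_pair_measure)
        have "ennreal ((1 - s * \<delta> / 2) ^ q) \<le> ennreal \<gamma>" using q by (intro ennreal_leI) simp
        then show "(\<integral>\<^sup>+T. emeasure (select_hyp Y s q p T) (excess_errors H Y D (\<alpha> + \<delta>)) \<partial>samples D q)
          \<le> indicator (?B \<times> ?B) p + ennreal \<gamma>"
          using s s' by (intro order_trans[OF select_hyp_failure[OF Y D p] add_left_mono]) auto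
      qed
      also have "\<dots> = emeasure (P S) (?B \<times> ?B) + ennreal \<gamma>"
        using meas by (subst nn_integral_add) (auto simp: PS PS.emeasure_space_1[unfolded PS(3)] intro!: borel_measurable_indicator)
      finally show "(\<integral>\<^sup>+p. \<integral>\<^sup>+T. emeasure (select_hyp Y s q p T) (excess_errors H Y D (\<alpha> + \<delta>)) \<partial>samples D q \<partial>P S)
        \<le> emeasure (P S) (?B \<times> ?B) + ennreal \<gamma>" .
    qed
    also have "\<dots> = (\<integral>\<^sup>+S. emeasure (P S) (?B \<times> ?B) \<partial>samples D (n + n')) + ennreal \<gamma>"
    proof -
      have "(\<lambda>S. emeasure (P S) (?B \<times> ?B)) \<in> borel_measurable (samples (examples X) (n + n'))"
        using meas by (intro measurable_emeasure_kernel[OF measurable_prob_algebraD[OF P]] pair_measureI)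
      then have "(\<lambda>S. emeasure (P S) (?B \<times> ?B)) \<in> borel_measurable (samples D (n + n'))"
        unfolding measurable_cong_sets[OF sets refl] .
      then show ?thesis by (subst nn_integral_add) (auto simp: nn.emeasure_space_1)
    qed
    also have "(\<integral>\<^sup>+S. emeasure (P S) (?B \<times> ?B) \<partial>samples D (n + n')) =
      (\<integral>\<^sup>+S. \<integral>\<^sup>+h. \<integral>\<^sup>+T. emeasure (distr (K' T) (Y \<Otimes>\<^sub>M Y) (Pair h)) (?B \<times> ?B) \<partial>samples D n' \<partial>K S \<partial>samples D n)"
      unfolding P_def by (rule nn_integral_par_comp[OF K pair D]) (intro pair_measureI meas)
    \<comment> \<open>Independence: with h fixed, integrating over the second block gives at most
      \<beta>' if h is bad and 0 otherwise.\<close>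
    also have "\<dots> \<le> (\<integral>\<^sup>+S. ennreal \<beta>' * emeasure (K S) ?B \<partial>samples D n)"
    proof (rule nn_integral_mono)
      fix S assume "S \<in> space (samples D n)"
      then have S: "S \<in> space (samples (examples X) n)" by (simp add: space)
      note KS = prob_kernelD[OF K S]
      have "(\<integral>\<^sup>+h. \<integral>\<^sup>+T. emeasure (distr (K' T) (Y \<Otimes>\<^sub>M Y) (Pair h)) (?B \<times> ?B) \<partial>samples D n' \<partial>K S)
        \<le> (\<integral>\<^sup>+h. ennreal \<beta>' * indicator ?B h \<partial>K S)"
      proof (rule nn_integral_mono)
        fix h assume h: "h \<in> space (K S)"
        have "emeasure (distr (K' T) (Y \<Otimes>\<^sub>M Y) (Pair h)) (?B \<times> ?B) = emeasure (K' T) ?B * indicator ?B h"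
          if "T \<in> space (samples D n')" for T
        proof -
          have "Pair h -` (?B \<times> ?B) \<inter> space Y = (if h \<in> ?B then ?B else {})"
            by (auto simp: excess_errors_def)
          moreover have "emeasure (distr (K' T) (Y \<Otimes>\<^sub>M Y) (Pair h)) (?B \<times> ?B) =
            emeasure (K' T) (Pair h -` (?B \<times> ?B) \<inter> space Y)"
            using that h by (intro emeasure_distr_kernel[OF K'] pair_measureI meas) (auto simp: space KS)
          ultimately show ?thesis by simp
        qed
        then have "(\<integral>\<^sup>+T. emeasure (distr (K' T) (Y \<Otimes>\<^sub>M Y) (Pair h)) (?B \<times> ?B) \<partial>samples D n')
          = (\<integral>\<^sup>+T. emeasure (K' T) ?B * indicator ?B h \<partial>samples D n')"
          by (rule nn_integral_cong)
        also have "\<dots> \<le> ennreal \<beta>' * indicator ?B h"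
          using \<beta>' by (cases "h \<in> ?B") simp_all
        finally show "(\<integral>\<^sup>+T. emeasure (distr (K' T) (Y \<Otimes>\<^sub>M Y) (Pair h)) (?B \<times> ?B) \<partial>samples D n') \<le> ennreal \<beta>' * indicator ?B h" .
      qed
      also have "\<dots> = ennreal \<beta>' * emeasure (K S) ?B"
        using meas by (intro nn_integral_cmult_indicator) (simp add: KS)
      finally show "(\<integral>\<^sup>+h. \<integral>\<^sup>+T. emeasure (distr (K' T) (Y \<Otimes>\<^sub>M Y) (Pair h)) (?B \<times> ?B) \<partial>samples D n' \<partial>K S)
        \<le> ennreal \<beta>' * emeasure (K S) ?B" .
    qed
    also have "\<dots> = ennreal \<beta>' * (\<integral>\<^sup>+S. emeasure (K S) ?B \<partial>samples D n)"
    proof (rule nn_integral_cmult)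
      have "(\<lambda>S. emeasure (K S) ?B) \<in> borel_measurable (samples (examples X) n)"
        using meas by (intro measurable_emeasure_kernel[OF measurable_prob_algebraD[OF K]])
      then show "(\<lambda>S. emeasure (K S) ?B) \<in> borel_measurable (samples D n)"
        unfolding measurable_cong_sets[OF sets refl] .
    qed
    also have "\<dots> \<le> ennreal \<beta>' * ennreal \<beta>"
      using 1 D by (intro mult_left_mono) (auto simp: private_learner_def)
    also have "\<dots> = ennreal (\<beta> * \<beta>')"
      using ennreal_mult'[OF \<beta>(1), of \<beta>'] by (simp add: mult.commute)
    finally have "(\<integral>\<^sup>+S. emeasure (L S) (excess_errors H Y D (\<alpha> + \<delta>)) \<partial>samples D (n + n' + q))
      \<le> ennreal (\<beta> * \<beta>') + ennreal \<gamma>"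
      by (auto intro: add_mono)
    also have "\<dots> = ennreal (\<beta> * \<beta>' + \<gamma>)"
      using \<beta> \<gamma> by (simp add: ennreal_plus)
    finally show ?thesis .
  qed
  then show ?thesis using L dpL unfolding private_learner_def by blast
qed

section \<open>Removal of the public sample\<close>

text \<open>Translates the success probability under the bind into the iterated integral of the
  failure mass used everywhere else.\<close>

lemma semi_private_failure_iff:
  assumes Y: "hypothesis_space X Y" and D: "prob_space D" "sets D = sets (examples X)"
    and A: "(\<lambda>(S, T). A S T) \<in> datasets X n \<Otimes>\<^sub>M datasets X m \<rightarrow>\<^sub>M prob_algebra Y" and \<beta>: "0 \<le> \<beta>"
  shows "1 - \<beta> \<le> \<P>(h in (iid_sample D n \<Otimes>\<^sub>M iid_sample D m) \<bind> (\<lambda>(S, T). A S T).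
            ereal (err h D) \<le> (INF h'\<in>H. ereal (err h' D)) + ereal \<alpha>) \<longleftrightarrow>
    (\<integral>\<^sup>+S. \<integral>\<^sup>+T. emeasure (A S T) (excess_errors H Y D \<alpha>) \<partial>samples D m \<partial>samples D n) \<le> ennreal \<beta>"
    (is "_ \<le> ?P \<longleftrightarrow> ?I \<le> _")
proof -
  define M where "M = (iid_sample D n \<Otimes>\<^sub>M iid_sample D m) \<bind> (\<lambda>(S, T). A S T)"
  let ?B = "excess_errors H Y D \<alpha>" and ?DD = "samples D n \<Otimes>\<^sub>M samples D m"
  interpret m: prob_space "samples D m" by (rule prob_space_samples) fact
  have sets: "sets (samples D k) = sets (datasets X k)" for k
    unfolding datasets_def by (intro sets_PiM_cong refl D(2))
  have setsDD: "sets ?DD = sets (datasets X n \<Otimes>\<^sub>M datasets X m)"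
    by (rule sets_pair_measure_cong[OF sets sets])
  have DD: "?DD \<in> space (prob_algebra (datasets X n \<Otimes>\<^sub>M datasets X m))"
    by (simp add: space_prob_algebra setsDD prob_space_pair prob_space_samples D)
  have M: "prob_space M" "sets M = sets Y"
    unfolding M_def iid_sample_def by (rule prob_space_bind'[OF DD A] sets_bind'[OF DD A])+
  interpret prob_space M by (rule M)
  have B: "?B \<in> sets Y" by (rule sets_excess_errors) fact+
  have meas: "(\<lambda>(S, T). emeasure (A S T) ?B) \<in> borel_measurable ?DD"
  proof -
    have "(\<lambda>(S, T). emeasure (A S T) ?B) \<in> borel_measurable (datasets X n \<Otimes>\<^sub>M datasets X m)"
      using measurable_emeasure_kernel[OF measurable_prob_algebraD[OF A] B] unfolding split_beta .
    then show ?thesis using measurable_cong_sets[OF setsDD refl] by blast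
  qed
  have "emeasure M ?B = (\<integral>\<^sup>+x. emeasure (case x of (S, T) \<Rightarrow> A S T) ?B \<partial>?DD)"
    unfolding M_def iid_sample_def by (rule emeasure_bind_prob_algebra[OF DD A B])
  also have "\<dots> = ?I"
    using m.nn_integral_fst[OF meas] by (simp add: case_prod_unfold)
  finally have I: "?I = ennreal (prob ?B)" by (simp add: emeasure_eq_measure)
  have "?P = prob (space M - ?B)"
    unfolding M_def[symmetric]
    by (rule arg_cong[where f="measure M"]) (auto simp: excess_errors_def sets_eq_imp_space_eq[OF M(2)])
  also have "\<dots> = 1 - prob ?B" using B M by (intro prob_compl) simp
  finally show ?thesis using \<beta> by (simp add: I ennreal_le_iff)
qed

section \<open>Mixtures and their simulation by masking\<close>

definition mixture :: "real \<Rightarrow> 'z measure \<Rightarrow> 'z measure \<Rightarrow> 'z measure" where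
  "mixture p N D = measure_pmf (bernoulli_pmf p) \<bind> (\<lambda>b. if b then D else N)"

text \<open>The coins and a full noise sample form the auxiliary randomness c, drawn independently
  of S even at indices where the noise is not read. For fixed c the map acts on each point
  separately, so neighbouring samples stay neighbouring.\<close>

definition mix_samples :: "nat \<Rightarrow> (nat \<Rightarrow> bool) \<times> (nat \<Rightarrow> 'z) \<Rightarrow> (nat \<Rightarrow> 'z) \<Rightarrow> nat \<Rightarrow> 'z" where
  "mix_samples n c S = (\<lambda>i\<in>{..<n}. if fst c i then S i else snd c i)"

definition mix_coins :: "real \<Rightarrow> 'z measure \<Rightarrow> nat \<Rightarrow> ((nat \<Rightarrow> bool) \<times> (nat \<Rightarrow> 'z)) measure" where
  "mix_coins p N n = samples (measure_pmf (bernoulli_pmf p)) n \<Otimes>\<^sub>M samples N n"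

context
  fixes p :: real and Z N D :: "'z measure"
  assumes p: "0 \<le> p" "p \<le> 1"
    and N: "prob_space N" "sets N = sets Z" and D: "prob_space D" "sets D = sets Z"
begin

lemma mixture_kernel: "(\<lambda>b. if b then D else N) \<in> measure_pmf (bernoulli_pmf p) \<rightarrow>\<^sub>M prob_algebra Z"
  using N D by (auto simp: space_prob_algebra measurable_def)

lemma mixture_coin: "measure_pmf (bernoulli_pmf p) \<in> space (prob_algebra (measure_pmf (bernoulli_pmf p)))"
  by (simp add: space_prob_algebra prob_space_measure_pmf)

lemma prob_space_mixture: "prob_space (mixture p N D)"
  unfolding mixture_def by (rule prob_space_bind'[OF mixture_coin mixture_kernel])

lemma sets_mixture: "sets (mixture p N D) = sets Z"
  unfolding mixture_def by (rule sets_bind'[OF mixture_coin mixture_kernel])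

lemma emeasure_mixture:
  "A \<in> sets Z \<Longrightarrow> emeasure (mixture p N D) A = (\<integral>\<^sup>+b. emeasure (if b then D else N) A \<partial>bernoulli_pmf p)"
  unfolding mixture_def by (rule emeasure_bind_prob_algebra[OF mixture_coin mixture_kernel])

lemma measure_mixture:
  assumes "A \<in> sets Z"
  shows "measure (mixture p N D) A = p * measure D A + (1 - p) * measure N A"
proof -
  interpret M: prob_space "mixture p N D" by (rule prob_space_mixture)
  interpret D: prob_space D by (rule D)
  interpret N: prob_space N by (rule N)
  show ?thesis using emeasure_mixture[OF assms] p
    by (simp add: M.emeasure_eq_measure D.emeasure_eq_measure N.emeasure_eq_measure
        ennreal_mult[symmetric] ennreal_plus[symmetric] mult.commute del: ennreal_plus)
qed

lemma sets_samples_Z: "sets (samples N n) = sets (samples Z n)" "sets (samples D n) = sets (samples Z n)"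
  by (intro sets_PiM_cong refl N(2) D(2))+

lemma space_samples_Z: "space (samples N n) = space (samples Z n)" "space (samples D n) = space (samples Z n)"
  by (intro sets_eq_imp_space_eq sets_samples_Z)+

lemma prob_space_mix_coins: "prob_space (mix_coins p N n)"
  unfolding mix_coins_def
  by (intro prob_space_pair prob_space_samples prob_space_measure_pmf N)

lemma measurable_mix_samples:
  "(\<lambda>(c, S). mix_samples n c S) \<in> mix_coins p N n \<Otimes>\<^sub>M samples Z n \<rightarrow>\<^sub>M samples Z n"
  unfolding mix_samples_def split_beta
proof (rule measurable_restrict)
  fix i assume i: "i \<in> {..<n}"
  have [measurable]: "(\<lambda>x. fst (fst x) i) \<in> mix_coins p N n \<Otimes>\<^sub>M samples Z n \<rightarrow>\<^sub>M count_space UNIV"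
    unfolding mix_coins_def
    using measurable_compose[OF measurable_compose[OF measurable_fst measurable_fst] measurable_component_singleton[OF i],
        of "\<lambda>_. measure_pmf (bernoulli_pmf p)" "samples N n" "samples Z n"]
    by simp
  have [measurable]: "(\<lambda>x. snd (fst x) i) \<in> mix_coins p N n \<Otimes>\<^sub>M samples Z n \<rightarrow>\<^sub>M Z"
    using measurable_compose[OF measurable_compose[OF measurable_fst measurable_snd]
        measurable_component_singleton[OF i], of "samples (measure_pmf (bernoulli_pmf p)) n" "\<lambda>_. N" "samples Z n"]
      measurable_cong_sets[OF refl N(2)]
    unfolding mix_coins_def by blast
  have [measurable]: "(\<lambda>x. snd x i) \<in> mix_coins p N n \<Otimes>\<^sub>M samples Z n \<rightarrow>\<^sub>M Z"
    by (rule measurable_compose[OF measurable_snd measurable_component_singleton[OF i]])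
  show "(\<lambda>x. if fst (fst x) i then snd x i else snd (fst x) i) \<in> mix_coins p N n \<Otimes>\<^sub>M samples Z n \<rightarrow>\<^sub>M Z"
    by measurable
qed

text \<open>Checked on boxes. For a fixed coin pattern b the preimage of a box is a product of a
  condition on the noise and one on the data; its probability is a product over indices, so
  integrating over the independent coins gives one mixture factor per index.\<close>

lemma distr_mix_samples:
  "distr (mix_coins p N n \<Otimes>\<^sub>M samples D n) (samples Z n) (\<lambda>(c, S). mix_samples n c S)
    = samples (mixture p N D) n"
proof -
  let ?B = "measure_pmf (bernoulli_pmf p)"
  interpret N: prob_space N by (rule N)
  interpret D: prob_space D by (rule D)
  interpret M: prob_space "mixture p N D" by (rule prob_space_mixture)
  interpret B: prob_space ?B by (rule prob_space_measure_pmf)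
  interpret PM: product_sigma_finite "\<lambda>_::nat. mixture p N D" by standard
  interpret PB: product_sigma_finite "\<lambda>_::nat. ?B" by standard
  interpret Nn: prob_space "samples N n" by (rule prob_space_samples) fact
  interpret Dn: prob_space "samples D n" by (rule prob_space_samples) fact
  have space: "space N = space Z" "space D = space Z"
    using N(2) D(2) by (auto dest: sets_eq_imp_space_eq)
  have "sets (mix_coins p N n \<Otimes>\<^sub>M samples D n) = sets (mix_coins p N n \<Otimes>\<^sub>M samples Z n)"
    by (rule sets_pair_measure_cong[OF refl sets_samples_Z(2)])
  then have mix: "(\<lambda>(c, S). mix_samples n c S) \<in> mix_coins p N n \<Otimes>\<^sub>M samples D n \<rightarrow>\<^sub>M samples Z n"
    using measurable_mix_samples measurable_cong_sets[OF _ refl] by blast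
  show ?thesis
  proof (rule PM.PiM_eqI)
    show "sets (distr (mix_coins p N n \<Otimes>\<^sub>M samples D n) (samples Z n) (\<lambda>(c, S). mix_samples n c S))
      = sets (samples (mixture p N D) n)"
      by (simp add: sets_PiM_cong[OF refl sets_mixture])
    fix A :: "nat \<Rightarrow> 'z set" assume "\<And>i. i \<in> {..<n} \<Longrightarrow> A i \<in> sets (mixture p N D)"
    then have A: "A i \<in> sets Z" if "i < n" for i using that by (simp add: sets_mixture)
    have AZ: "A i \<subseteq> space Z" if "i < n" for i using sets.sets_into_space[OF A[OF that]] .
    \<comment> \<open>For pattern b, \<open>W b\<close> constrains the noise at the masked indices
      and \<open>V b\<close> the data at the others.\<close>
    define W where "W b = (\<Pi>\<^sub>E i\<in>{..<n}. if b i then space Z else A i)" for b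
    define V where "V b = (\<Pi>\<^sub>E i\<in>{..<n}. if b i then A i else space Z)" for b
    define E where "E = (\<lambda>(c, S). mix_samples n c S) -` Pi\<^sub>E {..<n} A \<inter> space (mix_coins p N n \<Otimes>\<^sub>M samples D n)"
    have E: "E \<in> sets (mix_coins p N n \<Otimes>\<^sub>M samples D n)"
      unfolding E_def using A by (intro measurable_sets[OF mix] sets_PiM_I_finite) auto
    have W: "W b \<in> sets (samples N n)" for b
      unfolding W_def sets_samples_Z using A by (intro sets_PiM_I_finite) auto
    have eW: "emeasure (samples N n) (W b) = (\<Prod>i<n. if b i then 1 else emeasure N (A i))" for b
    proof -
      have "emeasure (samples N n) (W b) = (\<Prod>i<n. emeasure N (if b i then space Z else A i))"
        unfolding W_def by (rule emeasure_samples_PiE[OF N(1)]) (simp add: N(2) A)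
      also have "\<dots> = (\<Prod>i<n. if b i then 1 else emeasure N (A i))"
        by (intro prod.cong refl) (simp add: N.emeasure_space_1[unfolded space])
      finally show ?thesis .
    qed
    have eV: "emeasure (samples D n) (V b) = (\<Prod>i<n. if b i then emeasure D (A i) else 1)" for b
    proof -
      have "emeasure (samples D n) (V b) = (\<Prod>i<n. emeasure D (if b i then A i else space Z))"
        unfolding V_def by (rule emeasure_samples_PiE[OF D(1)]) (simp add: D(2) A)
      also have "\<dots> = (\<Prod>i<n. if b i then emeasure D (A i) else 1)"
        by (intro prod.cong refl) (simp add: D.emeasure_space_1[unfolded space])
      finally show ?thesis .
    qed
    have slice: "Pair (b, w) -` E = (if w \<in> W b then V b else {})" if w: "w \<in> space (samples Z n)"
      and b: "b \<in> space (samples ?B n)" for b w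
    proof (intro set_eqI)
      fix S
      have wZ: "\<And>i. i < n \<Longrightarrow> w i \<in> space Z" "w \<in> extensional {..<n}" using w by (simp_all add: space_PiM PiE_iff)
      have "S \<in> Pair (b, w) -` E \<longleftrightarrow> (\<forall>i<n. (if b i then S i else w i) \<in> A i) \<and> S \<in> space (samples Z n)"
        using w b by (auto simp: E_def mix_samples_def space_pair_measure mix_coins_def space_samples_Z PiE_iff)
      also have "\<dots> \<longleftrightarrow> (\<forall>i<n. b i \<longrightarrow> S i \<in> A i) \<and> (\<forall>i<n. \<not> b i \<longrightarrow> w i \<in> A i) \<and> S \<in> space (samples Z n)"
        by auto
      also have "\<dots> \<longleftrightarrow> S \<in> (if w \<in> W b then V b else {})"
        using wZ AZ[THEN subsetD] by (auto simp: W_def V_def space_PiM PiE_iff)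
      finally show "S \<in> Pair (b, w) -` E \<longleftrightarrow> S \<in> (if w \<in> W b then V b else {})" .
    qed
    have "emeasure (distr (mix_coins p N n \<Otimes>\<^sub>M samples D n) (samples Z n) (\<lambda>(c, S). mix_samples n c S)) (Pi\<^sub>E {..<n} A)
      = emeasure (mix_coins p N n \<Otimes>\<^sub>M samples D n) E"
      unfolding E_def using A by (subst emeasure_distr[OF mix]) (auto intro!: sets_PiM_I_finite)
    also have "\<dots> = (\<integral>\<^sup>+c. emeasure (samples D n) (Pair c -` E) \<partial>mix_coins p N n)"
      by (rule Dn.emeasure_pair_measure_alt[OF E])
    also have "\<dots> = (\<integral>\<^sup>+b. \<integral>\<^sup>+w. emeasure (samples D n) (Pair (b, w) -` E) \<partial>samples N n \<partial>samples ?B n)"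
      unfolding mix_coins_def
      by (rule Nn.nn_integral_fst[symmetric])
        (rule Dn.measurable_emeasure_Pair[OF E, unfolded mix_coins_def])
    also have "\<dots> = (\<integral>\<^sup>+b. \<integral>\<^sup>+w. emeasure (samples D n) (V b) * indicator (W b) w \<partial>samples N n \<partial>samples ?B n)"
      by (intro nn_integral_cong) (simp add: slice space_samples_Z)
    also have "\<dots> = (\<integral>\<^sup>+b. emeasure (samples D n) (V b) * emeasure (samples N n) (W b) \<partial>samples ?B n)"
      using W by (intro nn_integral_cong nn_integral_cmult_indicator)
    also have "\<dots> = (\<integral>\<^sup>+b. (\<Prod>i<n. emeasure (if b i then D else N) (A i)) \<partial>samples ?B n)"
      unfolding eW eV prod.distrib[symmetric]
      by (intro nn_integral_cong prod.cong) auto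
    also have "\<dots> = (\<Prod>i<n. \<integral>\<^sup>+b. emeasure (if b then D else N) (A i) \<partial>?B)"
      by (rule PB.product_nn_integral_prod) auto
    also have "\<dots> = (\<Prod>i<n. emeasure (mixture p N D) (A i))"
      using A by (simp add: emeasure_mixture)
    finally show "emeasure (distr (mix_coins p N n \<Otimes>\<^sub>M samples D n) (samples Z n) (\<lambda>(c, S). mix_samples n c S)) (Pi\<^sub>E {..<n} A)
      = (\<Prod>i\<in>{..<n}. emeasure (mixture p N D) (A i))" .
  qed simp
qed

lemma nn_integral_mix_samples:
  assumes f: "f \<in> borel_measurable (samples Z n)"
  shows "(\<integral>\<^sup>+S. f S \<partial>samples (mixture p N D) n) = (\<integral>\<^sup>+c. \<integral>\<^sup>+S. f (mix_samples n c S) \<partial>samples D n \<partial>mix_coins p N n)"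
    and "(\<integral>\<^sup>+S. f S \<partial>samples (mixture p N D) n) = (\<integral>\<^sup>+S. \<integral>\<^sup>+c. f (mix_samples n c S) \<partial>mix_coins p N n \<partial>samples D n)"
proof -
  interpret C: prob_space "mix_coins p N n" by (rule prob_space_mix_coins)
  interpret Dn: prob_space "samples D n" by (rule prob_space_samples) (rule D)
  interpret pair_sigma_finite "mix_coins p N n" "samples D n" ..
  have "sets (mix_coins p N n \<Otimes>\<^sub>M samples D n) = sets (mix_coins p N n \<Otimes>\<^sub>M samples Z n)"
    by (rule sets_pair_measure_cong[OF refl sets_samples_Z(2)])
  then have mix: "(\<lambda>(c, S). mix_samples n c S) \<in> mix_coins p N n \<Otimes>\<^sub>M samples D n \<rightarrow>\<^sub>M samples Z n"
    using measurable_mix_samples measurable_cong_sets[OF _ refl] by blast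
  have meas: "(\<lambda>(c, S). f (mix_samples n c S)) \<in> borel_measurable (mix_coins p N n \<Otimes>\<^sub>M samples D n)"
    using measurable_compose[OF mix f] by (simp add: split_beta)
  have "(\<integral>\<^sup>+S. f S \<partial>samples (mixture p N D) n) =
    (\<integral>\<^sup>+x. f (case x of (c, S) \<Rightarrow> mix_samples n c S) \<partial>(mix_coins p N n \<Otimes>\<^sub>M samples D n))"
    unfolding distr_mix_samples[symmetric] using f by (subst nn_integral_distr[OF mix]) auto
  also have "\<dots> = (\<integral>\<^sup>+c. \<integral>\<^sup>+S. f (mix_samples n c S) \<partial>samples D n \<partial>mix_coins p N n)"
    using Dn.nn_integral_fst[OF meas] by (simp add: case_prod_unfold)
  finally show 1: "(\<integral>\<^sup>+S. f S \<partial>samples (mixture p N D) n) = (\<integral>\<^sup>+c. \<integral>\<^sup>+S. f (mix_samples n c S) \<partial>samples D n \<partial>mix_coins p N n)" .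
  show "(\<integral>\<^sup>+S. f S \<partial>samples (mixture p N D) n) = (\<integral>\<^sup>+S. \<integral>\<^sup>+c. f (mix_samples n c S) \<partial>mix_coins p N n \<partial>samples D n)"
    unfolding 1 using Fubini'[OF meas] by simp
qed

text \<open>With probability \<open>(1 - p) ^ m\<close> a sample from the mixture consists of noise only.\<close>

lemma nn_integral_mixture_ge:
  assumes f: "f \<in> borel_measurable (samples Z m)"
  shows "ennreal ((1 - p) ^ m) * (\<integral>\<^sup>+T. f T \<partial>samples N m) \<le> (\<integral>\<^sup>+T. f T \<partial>samples (mixture p N D) m)"
proof -
  let ?B = "measure_pmf (bernoulli_pmf p)" and ?F = "\<Pi>\<^sub>E i\<in>{..<m}. {False}"
  interpret Nm: prob_space "samples N m" by (rule prob_space_samples) (rule N)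
  interpret Dm: prob_space "samples D m" by (rule prob_space_samples) (rule D)
  interpret Bm: prob_space "samples ?B m" by (rule prob_space_samples) (rule prob_space_measure_pmf)
  have F: "?F \<in> sets (samples ?B m)" by (intro sets_PiM_I_finite) auto
  have fN: "f \<in> borel_measurable (samples N m)"
    using f measurable_cong_sets[OF sets_samples_Z(1) refl] by blast
  have eF: "emeasure (samples ?B m) ?F = ennreal ((1 - p) ^ m)"
    using p by (subst emeasure_samples_PiE) (auto simp: prob_space_measure_pmf emeasure_pmf_single ennreal_power)
  have "ennreal ((1 - p) ^ m) * (\<integral>\<^sup>+T. f T \<partial>samples N m) =
    (\<integral>\<^sup>+b. (\<integral>\<^sup>+T. f T \<partial>samples N m) * indicator ?F b \<partial>samples ?B m)"
    by (simp only: nn_integral_cmult_indicator[OF F] eF mult.commute)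
  also have "\<dots> = (\<integral>\<^sup>+b. \<integral>\<^sup>+w. f w * indicator ?F b \<partial>samples N m \<partial>samples ?B m)"
    using fN by (simp add: nn_integral_multc)
  also have "\<dots> = (\<integral>\<^sup>+c. f (snd c) * indicator ?F (fst c) \<partial>mix_coins p N m)"
    unfolding mix_coins_def
    using F fN by (subst Nm.nn_integral_fst[symmetric]) auto
  also have "\<dots> \<le> (\<integral>\<^sup>+c. \<integral>\<^sup>+S. f (mix_samples m c S) \<partial>samples D m \<partial>mix_coins p N m)"
  proof (rule nn_integral_mono)
    fix c assume c: "c \<in> space (mix_coins p N m)"
    show "f (snd c) * indicator ?F (fst c) \<le> (\<integral>\<^sup>+S. f (mix_samples m c S) \<partial>samples D m)"
    proof (cases "fst c \<in> ?F")
      case True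
      have "mix_samples m c S = snd c" for S
        using c True by (auto simp: mix_samples_def mix_coins_def space_pair_measure space_PiM PiE_iff extensional_def fun_eq_iff)
      then show ?thesis by (simp add: Dm.emeasure_space_1 indicator_def)
    qed simp
  qed
  also have "\<dots> = (\<integral>\<^sup>+T. f T \<partial>samples (mixture p N D) m)"
    by (rule nn_integral_mix_samples(1)[OF f, symmetric])
  finally show ?thesis .
qed

end

section \<open>The noise distribution and elimination of public data\<close>

text \<open>Here \<open>undefined\<close> is the arbitrary point x0. As the image of a fair coin the
  measure makes sense even if the singleton of x0 is not measurable.\<close>

definition noise :: "'x measure \<Rightarrow> ('x \<times> bool) measure" where
  "noise X = distr (measure_pmf (bernoulli_pmf (1 / 2))) (examples X) (Pair undefined)"

context
  fixes X :: "'x measure"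
  assumes X: "space X = UNIV"
begin

lemma space_examples: "space (examples X) = UNIV"
  by (simp add: examples_def space_pair_measure X)

lemma measurable_noise: "Pair undefined \<in> measure_pmf (bernoulli_pmf (1 / 2)) \<rightarrow>\<^sub>M examples X"
  unfolding examples_def by (intro measurable_Pair) (auto simp: X)

lemma prob_space_noise: "prob_space (noise X)"
  unfolding noise_def by (intro prob_space.prob_space_distr prob_space_measure_pmf measurable_noise)

lemma sets_noise: "sets (noise X) = sets (examples X)"
  by (simp add: noise_def)

lemma err_eq:
  assumes "sets D = sets (examples X)"
  shows "err h D = measure D {z. h (fst z) \<noteq> snd z}"
  using sets_eq_imp_space_eq[OF assms] by (simp add: err_def space_examples)

lemma err_noise:
  assumes "{z. h (fst z) \<noteq> snd z} \<in> sets (examples X)"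
  shows "err h (noise X) = 1 / 2"
proof -
  have "err h (noise X) = measure (noise X) {z. h (fst z) \<noteq> snd z}"
    by (rule err_eq[OF sets_noise])
  also have "\<dots> = measure (bernoulli_pmf (1 / 2)) {b. h undefined \<noteq> b}"
    unfolding noise_def
    by (subst measure_distr[OF measurable_noise assms]) (simp add: vimage_def)
  also have "{b. h undefined \<noteq> b} = {\<not> h undefined}" by auto
  finally show ?thesis by (cases "h undefined") (simp_all add: measure_pmf_single)
qed

lemma err_mixture:
  assumes p: "0 \<le> p" "p \<le> 1" and D: "prob_space D" "sets D = sets (examples X)"
    and h: "{z. h (fst z) \<noteq> snd z} \<in> sets (examples X)"
  shows "err h (mixture p (noise X) D) = p * err h D + (1 - p) / 2"
  using measure_mixture[OF p prob_space_noise sets_noise D h] err_noise[OF h]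
  by (simp add: err_eq D sets_noise sets_mixture[OF p prob_space_noise sets_noise D])

text \<open>The error on the mixture is an affine function, with slope p, of the error on D. The
  offset (1 - p) / 2 is common to all hypotheses and cancels from every comparison.\<close>

lemma excess_errors_mixture:
  assumes p: "0 < p" "p \<le> 1" and D: "prob_space D" "sets D = sets (examples X)"
    and H: "H \<subseteq> X \<rightarrow>\<^sub>M count_space UNIV" and Y: "hypothesis_space X Y"
  shows "excess_errors H Y (mixture p (noise X) D) \<alpha> = excess_errors H Y D (\<alpha> / p)"
proof -
  \<comment> \<open>Competitors need not belong to the output space, so their measurability comes
    from the assumption on H.\<close>
  have mH: "{z. h (fst z) \<noteq> snd z} \<in> sets (examples X)" if "h \<in> H" for h
  proof -
    have [measurable]: "h \<in> X \<rightarrow>\<^sub>M count_space UNIV" using that H by auto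
    have "{z \<in> space (X \<Otimes>\<^sub>M count_space UNIV). h (fst z) \<noteq> snd z} \<in> sets (X \<Otimes>\<^sub>M count_space UNIV)"
      by measurable
    then show ?thesis unfolding examples_def[symmetric] space_examples by simp
  qed
  have mY: "{z. h (fst z) \<noteq> snd z} \<in> sets (examples X)" if "h \<in> space Y" for h
    using measurable_hypothesis[OF Y that refl] by (simp add: space_examples)
  have "err h' (mixture p (noise X) D) + \<alpha> < err h (mixture p (noise X) D) \<longleftrightarrow> err h' D + \<alpha> / p < err h D"
    if "h \<in> space Y" "h' \<in> H" for h h'
  proof -
    have e: "err h (mixture p (noise X) D) = p * err h D + (1 - p) / 2"
      "err h' (mixture p (noise X) D) = p * err h' D + (1 - p) / 2"
      using p by (intro err_mixture D mH mY that; simp)+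
    have "err h' D + \<alpha> / p < err h D \<longleftrightarrow> p * err h' D + \<alpha> < p * err h D"
      using p by (simp add: field_simps)
    then show ?thesis unfolding e by linarith
  qed
  then show ?thesis unfolding set_eq_iff excess_errors_iff by blast
qed

text \<open>K masks the private points, draws a public sample of pure noise and runs A. When A
  itself is run on the mixture, its public sample is pure noise with probability at least
  \<open>(1 - p) ^ m\<close>, independently of the private sample; thus \<open>(1 - p) ^ m\<close>
  times the failure probability of K is at most \<beta>.\<close>

lemma private_learner_of_semi_private:
  assumes H: "H \<subseteq> X \<rightarrow>\<^sub>M count_space UNIV" and Y: "hypothesis_space X Y"
    and A: "semi_private_learner_with X H Y n m \<alpha> \<beta> \<epsilon> A"
    and p: "0 < p" "p < 1" and \<beta>: "0 \<le> \<beta>" and \<epsilon>: "0 \<le> \<epsilon>"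
  shows "\<exists>K. private_learner X H Y \<epsilon> n (\<alpha> / p) (\<beta> / (1 - p) ^ m) K"
proof -
  let ?Z = "examples X" and ?N = "noise X"
  note N = prob_space_noise sets_noise
  have p': "0 \<le> p" "p \<le> 1" using p by auto
  have mA: "(\<lambda>(S, T). A S T) \<in> samples ?Z n \<Otimes>\<^sub>M samples ?Z m \<rightarrow>\<^sub>M prob_algebra Y"
    using A unfolding semi_private_learner_with_def datasets_def by blast
  have dpA: "differentially_private ?Z Y n \<epsilon> (\<lambda>S. A S T)" if "T \<in> space (samples ?Z m)" for T
    using A that unfolding semi_private_learner_with_def datasets_def by blast
  have setsN: "sets (samples ?N k) = sets (samples ?Z k)" for k
    by (intro sets_PiM_cong refl N(2))
  note spaceN = sets_eq_imp_space_eq[OF setsN]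
  interpret Nm: prob_space "samples ?N m" by (rule prob_space_samples) (rule N)
  define C where "C = mix_coins p ?N n \<Otimes>\<^sub>M samples ?N m"
  have probC: "prob_space C"
    unfolding C_def by (intro prob_space_pair prob_space_mix_coins[OF p' N N] prob_space_samples N)
  interpret C: prob_space C by (rule probC)
  have C: "C \<in> space (prob_algebra C)" by (simp add: space_prob_algebra probC)
  define f where "f S c = A (mix_samples n (fst c) S) (snd c)" for S c
  define K where "K S = C \<bind> f S" for S
  have mf: "(\<lambda>(S, c). f S c) \<in> samples ?Z n \<Otimes>\<^sub>M C \<rightarrow>\<^sub>M prob_algebra Y"
  proof -
    have "(\<lambda>x. (fst (snd x), fst x)) \<in> samples ?Z n \<Otimes>\<^sub>M C \<rightarrow>\<^sub>M mix_coins p ?N n \<Otimes>\<^sub>M samples ?Z n"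
      unfolding C_def by measurable
    from measurable_compose[OF this measurable_mix_samples[OF p' N N]]
    have 1: "(\<lambda>x. mix_samples n (fst (snd x)) (fst x)) \<in> samples ?Z n \<Otimes>\<^sub>M C \<rightarrow>\<^sub>M samples ?Z n"
      by simp
    have "(\<lambda>x. snd (snd x)) \<in> samples ?Z n \<Otimes>\<^sub>M C \<rightarrow>\<^sub>M samples ?N m"
      unfolding C_def by measurable
    then have 2: "(\<lambda>x. snd (snd x)) \<in> samples ?Z n \<Otimes>\<^sub>M C \<rightarrow>\<^sub>M samples ?Z m"
      using measurable_cong_sets[OF refl setsN] by blast
    from measurable_compose[OF measurable_Pair[OF 1 2] mA]
    show ?thesis by (simp add: f_def case_prod_unfold)
  qed
  have mK: "K \<in> samples ?Z n \<rightarrow>\<^sub>M prob_algebra Y"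
    unfolding K_def using measurable_bind_prob_space2[OF measurable_const[OF C] mf] .
  have mfS: "f S \<in> C \<rightarrow>\<^sub>M prob_algebra Y" if "S \<in> space (samples ?Z n)" for S
    using measurable_compose[OF _ mf, of "\<lambda>c. (S, c)"] that by simp
  have eK: "emeasure (K S) E = (\<integral>\<^sup>+c. emeasure (f S c) E \<partial>C)"
    if "S \<in> space (samples ?Z n)" "E \<in> sets Y" for S E
    unfolding K_def by (rule emeasure_bind_prob_algebra[OF C mfS that(2)]) (rule that)
  have mixS: "mix_samples n (fst c) S \<in> space (samples ?Z n)" "snd c \<in> space (samples ?Z m)"
    if "c \<in> space C" "S \<in> space (samples ?Z n)" for c S
    using measurable_space[OF measurable_mix_samples[OF p' N N], of "(fst c, S)"] that
    by (auto simp: C_def space_pair_measure spaceN)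
  have "differentially_private ?Z Y n \<epsilon> K"
  proof (rule differentially_privateI[OF mK])
    fix S S' E assume S: "S \<in> space (samples ?Z n)" "S' \<in> space (samples ?Z n)" and near: "near n S S'"
      and E: "E \<in> sets Y"
    \<comment> \<open>Privacy holds for each fixed outcome c of the auxiliary randomness, whose law
      does not depend on S, and so survives averaging.\<close>
    have "(\<integral>\<^sup>+c. emeasure (f S c) E \<partial>C) \<le> (\<integral>\<^sup>+c. ennreal (exp \<epsilon>) * emeasure (f S' c) E \<partial>C)"
    proof (rule nn_integral_mono)
      fix c assume c: "c \<in> space C"
      have "near n (mix_samples n (fst c) S) (mix_samples n (fst c) S')"
        using near unfolding near_def mix_samples_def by (elim exE) (rule exI, auto)
      moreover have "(\<lambda>S. A S (snd c)) \<in> samples ?Z n \<rightarrow>\<^sub>M prob_algebra Y"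
        using measurable_compose[OF _ mA, of "\<lambda>S. (S, snd c)"] mixS(2)[OF c S(1)] by simp
      ultimately show "emeasure (f S c) E \<le> ennreal (exp \<epsilon>) * emeasure (f S' c) E"
        unfolding f_def
        using differentially_private_emeasure_le[OF dpA[OF mixS(2)[OF c S(1)]] _ mixS(1)[OF c S(1)] mixS(1)[OF c S(2)] _ \<epsilon> E]
        by simp
    qed
    also have "\<dots> = ennreal (exp \<epsilon>) * (\<integral>\<^sup>+c. emeasure (f S' c) E \<partial>C)"
      using measurable_emeasure_kernel[OF measurable_prob_algebraD[OF mfS[OF S(2)]] E]
      by (rule nn_integral_cmult)
    finally show "emeasure (K S) E \<le> ennreal (exp \<epsilon>) * emeasure (K S') E"
      by (simp add: eK S E)
  qed
  moreover have "(\<integral>\<^sup>+S. emeasure (K S) (excess_errors H Y D (\<alpha> / p)) \<partial>samples D n) \<le> ennreal (\<beta> / (1 - p) ^ m)"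
    if D: "prob_space D" "sets D = sets ?Z" for D
  proof -
    define D' where "D' = mixture p ?N D"
    have D': "prob_space D'" "sets D' = sets ?Z"
      unfolding D'_def by (rule prob_space_mixture[OF p' N D] sets_mixture[OF p' N D])+
    define B where "B = excess_errors H Y D' \<alpha>"
    have B: "B = excess_errors H Y D (\<alpha> / p)"
      unfolding B_def D'_def using p by (intro excess_errors_mixture[OF _ _ D H Y]) auto
    have mB: "B \<in> sets Y" unfolding B_def by (rule sets_excess_errors[OF Y D'])
    have mA': "(\<lambda>(S, T). A S T) \<in> datasets X n \<Otimes>\<^sub>M datasets X m \<rightarrow>\<^sub>M prob_algebra Y"
      using mA by (simp add: datasets_def)
    have spaceD: "space (samples D n) = space (samples ?Z n)" "space (samples D' n) = space (samples ?Z n)"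
      by (intro sets_eq_imp_space_eq sets_PiM_cong refl D(2) D'(2))+
    define g where "g S = (\<integral>\<^sup>+T. emeasure (A S T) B \<partial>samples ?N m)" for S
    have mAB: "(\<lambda>(S, T). emeasure (A S T) B) \<in> borel_measurable (samples ?Z n \<Otimes>\<^sub>M samples ?Z m)"
      using measurable_emeasure_kernel[OF measurable_prob_algebraD[OF mA] mB] unfolding split_beta .
    have mAS: "(\<lambda>T. emeasure (A S T) B) \<in> borel_measurable (samples ?Z m)" if "S \<in> space (samples ?Z n)" for S
      using measurable_compose[OF _ mAB, of "\<lambda>T. (S, T)"] that by simp
    have mg: "g \<in> borel_measurable (samples ?Z n)"
    proof -
      have "sets (samples ?Z n \<Otimes>\<^sub>M samples ?N m) = sets (samples ?Z n \<Otimes>\<^sub>M samples ?Z m)"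
        by (rule sets_pair_measure_cong[OF refl setsN])
      then have "(\<lambda>(S, T). emeasure (A S T) B) \<in> borel_measurable (samples ?Z n \<Otimes>\<^sub>M samples ?N m)"
        using mAB measurable_cong_sets[OF _ refl] by blast
      then show ?thesis unfolding g_def by (rule Nm.borel_measurable_nn_integral)
    qed
    have "(\<integral>\<^sup>+S. emeasure (K S) (excess_errors H Y D (\<alpha> / p)) \<partial>samples D n)
      = (\<integral>\<^sup>+S. \<integral>\<^sup>+c. g (mix_samples n c S) \<partial>mix_coins p ?N n \<partial>samples D n)"
    proof (rule nn_integral_cong)
      fix S assume "S \<in> space (samples D n)"
      then have S: "S \<in> space (samples ?Z n)" by (simp add: spaceD)
      have m: "(\<lambda>c. emeasure (f S c) B) \<in> borel_measurable (mix_coins p ?N n \<Otimes>\<^sub>M samples ?N m)"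
        using measurable_emeasure_kernel[OF measurable_prob_algebraD[OF mfS[OF S]] mB]
        unfolding C_def .
      show "emeasure (K S) (excess_errors H Y D (\<alpha> / p)) = (\<integral>\<^sup>+c. g (mix_samples n c S) \<partial>mix_coins p ?N n)"
        unfolding B[symmetric] eK[OF S mB] unfolding C_def g_def Nm.nn_integral_fst[OF m, symmetric]
        by (simp add: f_def)
    qed
    also have "\<dots> = (\<integral>\<^sup>+S. g S \<partial>samples D' n)"
      unfolding D'_def by (rule nn_integral_mix_samples(2)[OF p' N D mg, symmetric])
    finally have K: "(\<integral>\<^sup>+S. emeasure (K S) (excess_errors H Y D (\<alpha> / p)) \<partial>samples D n) = (\<integral>\<^sup>+S. g S \<partial>samples D' n)" .
    have "ennreal ((1 - p) ^ m) * (\<integral>\<^sup>+S. g S \<partial>samples D' n) = (\<integral>\<^sup>+S. ennreal ((1 - p) ^ m) * g S \<partial>samples D' n)"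
    proof (rule nn_integral_cmult[symmetric])
      have "sets (samples D' n) = sets (samples ?Z n)" by (intro sets_PiM_cong refl D'(2))
      then show "g \<in> borel_measurable (samples D' n)"
        using mg measurable_cong_sets[OF _ refl] by blast
    qed
    \<comment> \<open>For each private sample separately, only the event of a pure noise public
      sample is kept on the right.\<close>
    also have "\<dots> \<le> (\<integral>\<^sup>+S. \<integral>\<^sup>+T. emeasure (A S T) B \<partial>samples D' m \<partial>samples D' n)"
      unfolding g_def D'_def
      by (intro nn_integral_mono nn_integral_mixture_ge[OF p' N D] mAS) (simp add: spaceD[unfolded D'_def])
    also have "\<dots> \<le> ennreal \<beta>"
      unfolding B_def
      using A D' semi_private_failure_iff[OF Y D' mA' \<beta>, of H \<alpha>]
      unfolding semi_private_learner_with_def by blast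
    finally have le: "ennreal ((1 - p) ^ m) * (\<integral>\<^sup>+S. g S \<partial>samples D' n) \<le> ennreal \<beta>" .
    have pos: "0 < (1 - p) ^ m" using p by simp
    have "(\<integral>\<^sup>+S. g S \<partial>samples D' n) = ennreal (1 / (1 - p) ^ m) * (ennreal ((1 - p) ^ m) * (\<integral>\<^sup>+S. g S \<partial>samples D' n))"
    proof -
      have "ennreal (1 / x) * (ennreal x * I) = I" if "0 < x" for x I
        using that by (simp add: mult.assoc[symmetric] ennreal_mult[symmetric])
      then show ?thesis using pos by simp
    qed
    also have "\<dots> \<le> ennreal (1 / (1 - p) ^ m) * ennreal \<beta>"
      using le by (rule mult_left_mono) simp
    also have "\<dots> = ennreal (\<beta> / (1 - p) ^ m)"
      using pos \<beta> by (simp add: ennreal_mult[symmetric])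
    finally show ?thesis unfolding K .
  qed
  ultimately show ?thesis using mK unfolding private_learner_def by blast
qed

end

section \<open>Amplification and the dichotomy\<close>

lemma private_learner_mono:
  assumes Y: "hypothesis_space X Y" and K: "private_learner X H Y \<epsilon> n \<alpha> \<beta> K" and le: "\<alpha> \<le> \<alpha>'" "\<beta> \<le> \<beta>'"
  shows "private_learner X H Y \<epsilon> n \<alpha>' \<beta>' K"
proof -
  have m: "K \<in> samples (examples X) n \<rightarrow>\<^sub>M prob_algebra Y"
    using K by (auto simp: private_learner_def)
  have "(\<integral>\<^sup>+S. emeasure (K S) (excess_errors H Y D \<alpha>') \<partial>samples D n) \<le> ennreal \<beta>'"
    if D: "prob_space D" "sets D = sets (examples X)" for D
  proof -
    have space: "space (samples D n) = space (samples (examples X) n)"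
      by (intro sets_eq_imp_space_eq sets_PiM_cong refl D(2))
    have "(\<integral>\<^sup>+S. emeasure (K S) (excess_errors H Y D \<alpha>') \<partial>samples D n) \<le>
      (\<integral>\<^sup>+S. emeasure (K S) (excess_errors H Y D \<alpha>) \<partial>samples D n)"
      using excess_errors_antimono[OF le(1)] sets_excess_errors[OF Y D]
      by (intro nn_integral_mono emeasure_mono) (simp_all add: space prob_kernelD(2)[OF m])
    also have "\<dots> \<le> ennreal \<beta>" using K D by (simp add: private_learner_def)
    also have "\<dots> \<le> ennreal \<beta>'" using le(2) by (rule ennreal_leI)
    finally show ?thesis .
  qed
  then show ?thesis using K by (auto simp: private_learner_def)
qed

text \<open>The additional points are ignored. Padding later makes the sample sizes of different
  learners distinct.\<close>

lemma private_learner_extend: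
  assumes Y: "hypothesis_space X Y" and K: "private_learner X H Y \<epsilon> n \<alpha> \<beta> K" and \<epsilon>: "0 \<le> \<epsilon>"
  shows "\<exists>L. private_learner X H Y \<epsilon> (n + m) \<alpha> \<beta> L"
proof -
  let ?R = "\<lambda>h (_ :: nat \<Rightarrow> 'a \<times> bool). return Y h"
  define L where "L = par_comp n m K ?R"
  have m: "K \<in> samples (examples X) n \<rightarrow>\<^sub>M prob_algebra Y"
    and dp: "differentially_private (examples X) Y n \<epsilon> K"
    using K by (auto simp: private_learner_def)
  have R: "(\<lambda>(h, T). ?R h T) \<in> Y \<Otimes>\<^sub>M samples (examples X) m \<rightarrow>\<^sub>M prob_algebra Y"
    using measurable_compose[OF measurable_fst measurable_return_prob_space] by (simp add: case_prod_unfold)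
  have "differentially_private (examples X) Y m \<epsilon> (?R h)" for h
    using \<epsilon> mult_right_mono[of 1 "exp \<epsilon>" "measure (return Y h) _"]
    by (auto simp: differentially_private_def)
  then have dpL: "differentially_private (examples X) Y (n + m) \<epsilon> L"
    unfolding L_def by (intro differentially_private_par_comp[OF m R dp] \<epsilon>)
  have "(\<integral>\<^sup>+S. emeasure (L S) (excess_errors H Y D \<alpha>) \<partial>samples D (n + m)) \<le> ennreal \<beta>"
    if D: "prob_space D" "sets D = sets (examples X)" for D
  proof -
    interpret m: prob_space "samples D m" by (rule prob_space_samples) fact
    note B = sets_excess_errors[OF Y D, of H \<alpha>]
    have space: "space (samples D n) = space (samples (examples X) n)"
      by (intro sets_eq_imp_space_eq sets_PiM_cong refl D(2))
    have "(\<integral>\<^sup>+S. emeasure (L S) (excess_errors H Y D \<alpha>) \<partial>samples D (n + m)) =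
      (\<integral>\<^sup>+S. \<integral>\<^sup>+h. \<integral>\<^sup>+T. emeasure (return Y h) (excess_errors H Y D \<alpha>) \<partial>samples D m \<partial>K S \<partial>samples D n)"
      unfolding L_def by (rule nn_integral_par_comp[OF m R D B])
    also have "\<dots> = (\<integral>\<^sup>+S. emeasure (K S) (excess_errors H Y D \<alpha>) \<partial>samples D n)"
      using B by (intro nn_integral_cong) (simp add: m.emeasure_space_1 space prob_kernelD(2)[OF m])
    also have "\<dots> \<le> ennreal \<beta>" using K D by (simp add: private_learner_def)
    finally show ?thesis .
  qed
  then show ?thesis using measurable_par_comp[OF m R] dpL unfolding private_learner_def L_def by blast
qed

text \<open>Each round runs two copies of the previous learner on disjoint data. A round also spends
  half of the allowed excess error, so the induction is over all \<alpha> at once, and weak learners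
  of every accuracy with the same failure bound must be available.\<close>

lemma private_learner_boost:
  assumes Y: "hypothesis_space X Y" and \<epsilon>: "0 < \<epsilon>" and \<beta>\<^sub>0: "0 < \<beta>\<^sub>0" "\<beta>\<^sub>0 < 1"
    and weak: "\<And>\<alpha>. 0 < \<alpha> \<Longrightarrow> \<exists>n K. private_learner X H Y \<epsilon> n \<alpha> \<beta>\<^sub>0 K"
    and \<alpha>: "0 < \<alpha>" and \<beta>: "0 < \<beta>"
  shows "\<exists>n K. private_learner X H Y \<epsilon> n \<alpha> \<beta> K"
proof -
  \<comment> \<open>A uniform bound on the contraction factor (1 + b) / 2 of a round, valid since b
    never exceeds \<open>\<beta>\<^sub>0\<close>.\<close>
  define r where "r = (1 + \<beta>\<^sub>0) / 2"
  have r: "0 < r" "r < 1" using \<beta>\<^sub>0 by (auto simp: r_def)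
  have "\<forall>\<alpha>>0. \<exists>n K. private_learner X H Y \<epsilon> n \<alpha> (\<beta>\<^sub>0 * r ^ k) K" for k
  proof (induction k)
    case 0
    then show ?case using weak by simp
  next
    case (Suc k)
    show ?case
    proof (intro allI impI)
      fix \<alpha> :: real assume "0 < \<alpha>"
      define b where "b = \<beta>\<^sub>0 * r ^ k"
      have "r ^ k \<le> 1" using r by (intro power_le_one) auto
      then have b: "0 < b" "b \<le> \<beta>\<^sub>0" using \<beta>\<^sub>0 r by (auto simp: b_def mult_le_cancel_left2)
      obtain n K where "private_learner X H Y \<epsilon> n (\<alpha> / 2) b K"
        using Suc \<open>0 < \<alpha>\<close> unfolding b_def by (meson half_gt_zero)
      \<comment> \<open>The selection may fail with half of the gain b - b^2; the new failure bound
        is then b (1 + b) / 2.\<close>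
      moreover have "0 < b * (1 - b) / 2" using b \<beta>\<^sub>0 by simp
      ultimately obtain N L where L: "private_learner X H Y \<epsilon> N (\<alpha> / 2 + \<alpha> / 2) (b * b + b * (1 - b) / 2) L"
        using private_learner_select[OF Y \<epsilon>, of "\<alpha> / 2" "b * (1 - b) / 2" b b H n "\<alpha> / 2" K n K] \<open>0 < \<alpha>\<close> b by auto
      have "b * b + b * (1 - b) / 2 = b * ((1 + b) / 2)" by (simp add: field_simps)
      also have "\<dots> \<le> b * r" using b by (intro mult_left_mono) (auto simp: r_def)
      finally have "b * b + b * (1 - b) / 2 \<le> \<beta>\<^sub>0 * r ^ Suc k" by (simp add: b_def mult_ac)
      from private_learner_mono[OF Y L _ this, of \<alpha>]
      show "\<exists>n K. private_learner X H Y \<epsilon> n \<alpha> (\<beta>\<^sub>0 * r ^ Suc k) K" by auto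
    qed
  qed
  note iterate = this
  obtain k where "r ^ k < \<beta>" using real_arch_pow_inv[OF \<beta> r(2)] by blast
  moreover have "\<beta>\<^sub>0 * r ^ k \<le> 1 * r ^ k" using \<beta>\<^sub>0 r by (intro mult_right_mono) auto
  ultimately have "\<beta>\<^sub>0 * r ^ k \<le> \<beta>" by simp
  with iterate \<alpha> show ?thesis using private_learner_mono[OF Y _ order_refl] by blast
qed

section \<open>Gluing private learners into one algorithm\<close>

lemma semi_private_of_private_learner:
  assumes Y: "hypothesis_space X Y" and K: "private_learner X H Y \<epsilon> n \<alpha> \<beta> K" and \<beta>: "0 \<le> \<beta>"
  shows "semi_private_learner_with X H Y n 0 \<alpha> \<beta> \<epsilon> (\<lambda>S T. K S)"
proof -
  have m: "K \<in> samples (examples X) n \<rightarrow>\<^sub>M prob_algebra Y"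
    and dp: "differentially_private (examples X) Y n \<epsilon> K"
    using K by (auto simp: private_learner_def)
  have A: "(\<lambda>(S, T). K S) \<in> datasets X n \<Otimes>\<^sub>M datasets X 0 \<rightarrow>\<^sub>M prob_algebra Y"
    using measurable_compose[OF measurable_fst m] by (simp add: datasets_def case_prod_unfold)
  have "(\<integral>\<^sup>+S. \<integral>\<^sup>+T. emeasure (K S) (excess_errors H Y D \<alpha>) \<partial>samples D 0 \<partial>samples D n) \<le> ennreal \<beta>"
    if D: "prob_space D" "sets D = sets (examples X)" for D
  proof -
    interpret prob_space "samples D 0" by (rule prob_space_samples) fact
    show ?thesis using K D emeasure_space_1 by (simp add: private_learner_def)
  qed
  then show ?thesis
    unfolding semi_private_learner_with_def
    using A dp semi_private_failure_iff[OF Y _ _ A \<beta>, of _ H \<alpha>] by auto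
qed

lemma pure_privately_learnable_of_private_learners:
  assumes Y: "hypothesis_space X Y"
    and learners: "\<And>\<alpha> \<beta>. 0 < \<alpha> \<Longrightarrow> 0 < \<beta> \<Longrightarrow> \<exists>n K. private_learner X H Y (1 / 10) n \<alpha> \<beta> K"
  shows "pure_privately_learnable X H"
proof -
  have "\<exists>n K. private_learner X H Y (1 / 10) n (1 / Suc k) (1 / Suc k) K" for k
    by (rule learners) auto
  then obtain n where n: "\<And>k. \<exists>K. private_learner X H Y (1 / 10) (n k) (1 / Suc k) (1 / Suc k) K"
    by metis
  text \<open>The algorithm must recover the accuracy level \<open>k\<close> from the private sample size alone, so
    these sizes are made distinct.\<close>
  define N where "N k = (\<Sum>j\<le>k. Suc (n j))" for k
  have "strict_mono N" by (rule strict_mono_Suc_iff[THEN iffD2]) (simp add: N_def)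
  then have inv: "inv N (N k) = k" for k by (intro inv_f_f strict_mono_imp_inj_on)
  have "\<exists>K. private_learner X H Y (1 / 10) (N k) (1 / Suc k) (1 / Suc k) K" for k
  proof -
    have "n k \<le> N k" unfolding N_def using member_le_sum[of k "{..k}" "\<lambda>j. Suc (n j)"] by simp
    then obtain m where "N k = n k + m" using le_Suc_ex by blast
    then show ?thesis using n[of k] private_learner_extend[OF Y] by auto
  qed
  then obtain K where K: "\<And>k. private_learner X H Y (1 / 10) (N k) (1 / Suc k) (1 / Suc k) (K k)"
    by metis
  \<comment> \<open>Rounding up makes 1 / (level + 1) at most the smaller of \<alpha> and \<beta>,
    so one index controls both parameters.\<close>
  define level where "level \<alpha> \<beta> = nat \<lceil>1 / min \<alpha> \<beta>\<rceil>" for \<alpha> \<beta> :: real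
  have level: "1 / Suc (level \<alpha> \<beta>) \<le> \<alpha>" "1 / Suc (level \<alpha> \<beta>) \<le> \<beta>" if "0 < \<alpha>" "0 < \<beta>" for \<alpha> \<beta>
  proof -
    have pos: "0 < min \<alpha> \<beta>" using that by simp
    have "1 / min \<alpha> \<beta> \<le> Suc (level \<alpha> \<beta>)"
      unfolding level_def by linarith
    moreover have "1 / x \<le> Suc k \<Longrightarrow> 0 < x \<Longrightarrow> 1 / Suc k \<le> x" for x k
      by (simp add: field_simps)
    ultimately have "1 / Suc (level \<alpha> \<beta>) \<le> min \<alpha> \<beta>" using pos by blast
    then show "1 / Suc (level \<alpha> \<beta>) \<le> \<alpha>" "1 / Suc (level \<alpha> \<beta>) \<le> \<beta>" by linarith+
  qed
  \<comment> \<open>For sizes outside the range of N the level is arbitrary; the learner is only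
    ever run at sizes \<open>N k\<close>.\<close>
  define A where "A n (m::nat) S (T :: nat \<Rightarrow> 'a \<times> bool) = K (inv N n) S" for n m S T
  have "semi_private_learner_with X H Y (N (level \<alpha> \<beta>)) 0 \<alpha> \<beta> (1 / 10) (A (N (level \<alpha> \<beta>)) 0)"
    if "\<alpha> \<in> {0<..<1}" "\<beta> \<in> {0<..<1}" for \<alpha> \<beta>
  proof -
    have "A (N (level \<alpha> \<beta>)) 0 = (\<lambda>S T. K (level \<alpha> \<beta>) S)" by (simp add: A_def inv fun_eq_iff)
    then show ?thesis
      using private_learner_mono[OF Y K level[of \<alpha> \<beta>]] that
      by (auto intro: semi_private_of_private_learner[OF Y])
  qed
  then have "pure_semi_private_learner X H Y A (\<lambda>\<alpha> \<beta>. N (level \<alpha> \<beta>)) (\<lambda>_ _. 0)"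
    unfolding pure_semi_private_learner_def using Y by simp
  then show ?thesis unfolding pure_privately_learnable_def by blast
qed

section \<open>The two halves of the dichotomy\<close>

text \<open>Otherwise c would serve as the constant of the lower bound on the whole interval from 0
  to \<eta>.\<close>

lemma not_bigomega_inverseD:
  fixes g :: "real \<Rightarrow> nat"
  assumes "(\<lambda>\<alpha>. real (g \<alpha>)) \<notin> \<Omega>[at_right 0](\<lambda>\<alpha>. 1 / \<alpha>)" and c: "0 < c" and \<eta>: "0 < \<eta>"
  shows "\<exists>\<alpha>. 0 < \<alpha> \<and> \<alpha> < \<eta> \<and> real (g \<alpha>) * \<alpha> < c"
proof (rule ccontr)
  assume neg: "\<nexists>\<alpha>. 0 < \<alpha> \<and> \<alpha> < \<eta> \<and> real (g \<alpha>) * \<alpha> < c"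
  have "eventually (\<lambda>\<alpha>. norm (real (g \<alpha>)) \<ge> c * norm (1 / \<alpha>)) (at_right 0)"
    using eventually_at_right_less[of "0::real"] eventually_at_right_real[OF \<eta>]
  proof eventually_elim
    case (elim \<alpha>)
    then have "c \<le> real (g \<alpha>) * \<alpha>" using neg by (force simp: not_less)
    then show ?case using elim by (simp add: field_simps)
  qed
  with assms(1) c show False by (blast intro: landau_omega.bigI)
qed

lemma pure_privately_learnable_if_not_lower_bound:
  assumes X: "space X = UNIV" and H: "H \<subseteq> X \<rightarrow>\<^sub>M count_space UNIV" and neg: "\<not> public_sample_lower_bound X H"
  shows "pure_privately_learnable X H"
proof -
  obtain Y A n_priv n_pub \<beta> where learner: "pure_semi_private_learner X H Y A n_priv n_pub"
    and \<beta>: "0 < \<beta>" "\<beta> < 1" and small: "(\<lambda>\<alpha>. real (n_pub \<alpha> \<beta>)) \<notin> \<Omega>[at_right 0](\<lambda>\<alpha>. 1 / \<alpha>)"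
    using neg unfolding public_sample_lower_bound_def by auto
  have Y: "hypothesis_space X Y" using learner by (simp add: pure_semi_private_learner_def)
  \<comment> \<open>This is \<beta> divided by (1 + \<beta>) / 2, the lower bound obtained below for
    the probability of a pure noise public sample; it is below 1 because \<beta> is.\<close>
  define \<beta>\<^sub>0 where "\<beta>\<^sub>0 = 2 * \<beta> / (1 + \<beta>)"
  have \<beta>\<^sub>0: "0 < \<beta>\<^sub>0" "\<beta>\<^sub>0 < 1" using \<beta> by (auto simp: \<beta>\<^sub>0_def field_simps)
  have weak: "\<exists>n K. private_learner X H Y (1 / 10) n \<alpha>\<^sub>0 \<beta>\<^sub>0 K" if \<alpha>\<^sub>0: "0 < \<alpha>\<^sub>0" for \<alpha>\<^sub>0
  proof -
    \<comment> \<open>With \<alpha> < c and m \<alpha> < c, the quantity 2 \<alpha> (m + 1) is below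
      4 c, and dividing by 1 - \<beta> gives \<alpha> / p \<le> \<open>\<alpha>\<^sub>0\<close>. The
      additional bound \<alpha> < 1 makes the guarantee of the given learner applicable.\<close>
    define c where "c = \<alpha>\<^sub>0 * (1 - \<beta>) / 4"
    have c: "0 < c" using \<alpha>\<^sub>0 \<beta> by (simp add: c_def)
    then have "0 < min 1 c" by simp
    from not_bigomega_inverseD[OF small c this]
    obtain \<alpha> where \<alpha>: "0 < \<alpha>" "\<alpha> < 1" "\<alpha> < c" "real (n_pub \<alpha> \<beta>) * \<alpha> < c" by auto
    let ?m = "n_pub \<alpha> \<beta>"
    \<comment> \<open>Chosen so that m p \<le> (1 - \<beta>) / 2, whence \<open>(1 - p) ^ m\<close>
      \<ge> (1 + \<beta>) / 2 by Bernoulli's inequality. The summand 1 also covers m = 0.\<close>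
    define p where "p = (1 - \<beta>) / (2 * (real ?m + 1))"
    have p: "0 < p" "p < 1" using \<beta> by (auto simp: p_def field_simps add_pos_nonneg)
    have "real ?m * p \<le> (1 - \<beta>) / 2"
      using \<beta> by (simp add: p_def field_simps)
    moreover have "1 - real ?m * p \<le> (1 - p) ^ ?m"
      using Bernoulli_inequality[of "- p" ?m] p by simp
    ultimately have pm: "(1 + \<beta>) / 2 \<le> (1 - p) ^ ?m" by (simp add: field_simps)
    have "\<beta> / (1 - p) ^ ?m \<le> \<beta> / ((1 + \<beta>) / 2)"
      using \<beta> by (intro divide_left_mono[OF pm]) (auto intro!: mult_pos_pos simp: p)
    then have "\<beta> / (1 - p) ^ ?m \<le> \<beta>\<^sub>0" by (simp add: \<beta>\<^sub>0_def mult.commute)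
    moreover have "\<alpha> / p \<le> \<alpha>\<^sub>0"
    proof -
      have "\<alpha> * (real ?m + 1) * 2 \<le> \<alpha>\<^sub>0 * (1 - \<beta>)"
        using \<alpha> by (simp add: c_def algebra_simps)
      then show ?thesis using \<beta> by (simp add: p_def field_simps)
    qed
    moreover have "semi_private_learner_with X H Y (n_priv \<alpha> \<beta>) ?m \<alpha> \<beta> (1 / 10) (A (n_priv \<alpha> \<beta>) ?m)"
      using learner \<alpha> \<beta> by (simp add: pure_semi_private_learner_def)
    from private_learner_of_semi_private[OF X H Y this p]
    obtain K where "private_learner X H Y (1 / 10) (n_priv \<alpha> \<beta>) (\<alpha> / p) (\<beta> / (1 - p) ^ ?m) K"
      using \<beta> by auto
    ultimately show ?thesis using private_learner_mono[OF Y] by blast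
  qed
  show ?thesis
    by (rule pure_privately_learnable_of_private_learners[OF Y])
      (rule private_learner_boost[OF Y _ \<beta>\<^sub>0 weak], simp_all)
qed

text \<open>A learner with no public points refutes the bound already at \<beta> = 1/2: it would
  give c / \<alpha> \<le> 0 for all small \<alpha> > 0, and right neighbourhoods of 0 are
  nonempty.\<close>

lemma not_lower_bound_if_pure_privately_learnable:
  assumes "pure_privately_learnable X H"
  shows "\<not> public_sample_lower_bound X H"
proof
  assume lb: "public_sample_lower_bound X H"
  obtain Y A n_priv n_pub where learner: "pure_semi_private_learner X H Y A n_priv n_pub"
    and zero: "\<forall>\<alpha>\<in>{0<..<1}. \<forall>\<beta>\<in>{0<..<1}. n_pub \<alpha> \<beta> = 0"
    using assms unfolding pure_privately_learnable_def by blast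
  have "(\<lambda>\<alpha>. real (n_pub \<alpha> (1 / 2))) \<in> \<Omega>[at_right 0](\<lambda>\<alpha>. 1 / \<alpha>)"
    using lb learner unfolding public_sample_lower_bound_def by simp
  then obtain c where c: "0 < c"
    and ev: "eventually (\<lambda>\<alpha>. norm (real (n_pub \<alpha> (1 / 2))) \<ge> c * norm (1 / \<alpha>)) (at_right 0)"
    by (rule landau_omega.bigE)
  have "eventually (\<lambda>\<alpha>. False) (at_right (0::real))"
    using ev eventually_at_right_real[OF zero_less_one]
  proof eventually_elim
    case (elim \<alpha>)
    then show False using zero c by (auto simp: field_simps)
  qed
  then show False by simp
qed

theorem theorem4p2:
  fixes X :: "'x measure" and H :: "('x \<Rightarrow> bool) set"
  assumes "space X = UNIV"
    and "H \<subseteq> X \<rightarrow>\<^sub>M count_space UNIV"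
  shows "(pure_privately_learnable X H \<or> public_sample_lower_bound X H) \<and>
         \<not> (pure_privately_learnable X H \<and> public_sample_lower_bound X H)"
  using pure_privately_learnable_if_not_lower_bound[OF assms]
    not_lower_bound_if_pure_privately_learnable by blast

end
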